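(* Assume the local stability conditions hold, i.e. for every non-empty strict subset $\mathcal{T}\subsetneq\mathcal{S}$, $$p_{\mathcal{T}} < \frac{1}{N\mu}\,\mu_{\mathcal{T}},$$ or equivalently, for every non-empty strict subset $U\subsetneq\{1,\dots,N\}$, $\sum_{S\in\mathcal{S}:\,S\subseteq U}p_S<\frac{1}{N\mu}\sum_{n\in U}\mu_n$. Then, for both the c.o.c. and the c.o.s. mechanisms, $$\left(1-\frac{\lambda}{\mu}\right)(Q_S)_{S\in\mathcal{S}}\ \xrightarrow{d}\ \mathrm{Exp}(1)\,(p_S)_{S\in\mathcal{S}}\qquad\text{as }\lambda\uparrow\mu,$$ where $\mathrm{Exp}(1)$ denotes one single unit-mean exponential random variable multiplying the deterministic vector $(p_S)_{S\in\mathcal{S}}$.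
   Context: System. There are $N$ parallel servers with speeds $\mu_1,\dots,\mu_N>0$. The set of job types $\mathcal{S}$ is a non-empty collection of non-empty subsets of $\{1,\dots,N\}$, and $(p_S)_{S\in\mathcal{S}}$ are fixed with $p_S>0$, $\sum_{S\in\mathcal{S}}p_S=1$. Every server belongs to at least one $S\in\mathcal{S}$. For $\lambda>0$, type-$S$ jobs arrive as independent Poisson processes of rate $N\lambda p_S$. Each arriving type-$S$ job is replicated to all servers in $S$; each server works First-Come First-Served, and a replica run on server $n$ takes an exponential time with rate $\mu_n$ (unit-mean exponential size, speed $\mu_n$). Cancel-on-completion (c.o.c.): replica sizes are independent; as soon as the first replica of a job finishes service, its remaining replicas are discarded. Cancel-on-start (c.o.s.): as soon as the first replica of a job starts service, its remaining replicas are discarded (replica sizes need not be independent); a server that becomes available takes the longest waiting compatible job, and an arriving job that finds several compatible idle servers is assigned to the one that has been idle longest (ALIS rule). Notation. $\mu=\frac1N\sum_{n=1}^N\mu_n$; for $\mathcal{T}\subseteq\mathcal{S}$, $p_{\mathcal{T}}=\sum_{S\in\mathcal{T}}p_S$ and $\mu_{\mathcal{T}}=\sum_{n\in\bigcup_{S\in\mathcal{T}}S}\mu_n$. For $c_1,\dots,c_i\in\mathcal{S}$, $\mu(c_1,\dots,c_i)=\sum_{n\in c_1\cup\dots\cup c_i}\mu_n$. Stability (known). Under either mechanism the system is stable iff $N\lambda p_{\mathcal{T}}<\mu_{\mathcal{T}}$ for all non-empty $\mathcal{T}\subseteq\mathcal{S}$. Under the local stability conditions this holds for all $\lambda<\mu$.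 Stationary distributions (known). c.o.c.: the state $(c_1,\dots,c_M)$ lists the types of all jobs present in order of arrival (oldest first), and $\pi_{\text{c.o.c.}}(c_1,\dots,c_M)=C\prod_{i=1}^M\frac{N\lambda p_{c_i}}{\mu(c_1,\dots,c_i)}$. c.o.s.: the state $(c_1,\dots,c_{M};u_1,\dots,u_L)$ lists the types of all waiting jobs in order of arrival and the idle servers in order of idleness (longest idle first), where no waiting job is compatible with an idle server, and $\pi_{\text{c.o.s.}}(\boldsymbol c,\boldsymbol u)=C'\prod_{i=1}^{M}\frac{N\lambda p_{c_i}}{\mu(c_1,\dots,c_i)}\prod_{l=1}^L\frac{\mu_{u_l}}{\lambda_{\mathcal{C}(u_1,\dots,u_l)}}$ with $\lambda_{\mathcal{C}(u_1,\dots,u_l)}=N\lambda\sum_{S\in\mathcal{S}:\,S\cap\{u_1,\dots,u_l\}\ne\emptyset}p_S$. Here $C,C'$ are normalization constants. $(Q_S)_{S\in\mathcal{S}}$ is a random vector with the stationary distribution of the total number of jobs of each type in the system (including those in service); it depends on $\lambda$. $\xrightarrow{d}$ denotes convergence in distribution. *)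

theory Defs
  imports "HOL-Probability.Probability"
begin

(* The servers are the elements of a finite type 'n (so N = CARD('n)), a job type is the set of
   servers to which its jobs are replicated, and \<S> :: 'n set set is the collection of job types. *)

definition avg_speed :: "('n::finite \<Rightarrow> real) \<Rightarrow> real" where
  "avg_speed \<mu> = (\<Sum>n\<in>UNIV. \<mu> n) / real CARD('n)"

definition local_stability :: "('n::finite \<Rightarrow> real) \<Rightarrow> 'n set set \<Rightarrow> ('n set \<Rightarrow> real) \<Rightarrow> bool" where
  "local_stability \<mu> \<S> p \<longleftrightarrow>
     (\<forall>\<T>. \<T> \<noteq> {} \<and> \<T> \<subset> \<S> \<longrightarrow>
        (\<Sum>S\<in>\<T>. p S) < 1 / (real CARD('n) * avg_speed \<mu>) * (\<Sum>n\<in>\<Union>\<T>. \<mu> n))"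

definition local_stability_servers ::
    "('n::finite \<Rightarrow> real) \<Rightarrow> 'n set set \<Rightarrow> ('n set \<Rightarrow> real) \<Rightarrow> bool" where
  "local_stability_servers \<mu> \<S> p \<longleftrightarrow>
     (\<forall>U. U \<noteq> {} \<and> U \<subset> UNIV \<longrightarrow>
        (\<Sum>S | S \<in> \<S> \<and> S \<subseteq> U. p S) < 1 / (real CARD('n) * avg_speed \<mu>) * (\<Sum>n\<in>U. \<mu> n))"

(* Both mechanisms are Markov jump processes driven by two families of Poisson events: arrivals of
   type-S jobs (rate N lam p S) and potential service completions at server n (rate \<mu> n, without
   effect when the server is idle).  By memorylessness the state need not record residual sizes.
   If arr S x and dep n x are the states after these events when they occur in state x, then
   jump_rate is the resulting rate from x to y. *)
definition jump_rate ::
    "('n::finite \<Rightarrow> real) \<Rightarrow> 'n set set \<Rightarrow> ('n set \<Rightarrow> real) \<Rightarrow> real \<Rightarrow>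
     ('n set \<Rightarrow> 's \<Rightarrow> 's) \<Rightarrow> ('n \<Rightarrow> 's \<Rightarrow> 's) \<Rightarrow> 's \<Rightarrow> 's \<Rightarrow> real" where
  "jump_rate \<mu> \<S> p lam arr dep x y =
     (\<Sum>S | S \<in> \<S> \<and> arr S x = y. real CARD('n) * lam * p S) + (\<Sum>n | dep n x = y. \<mu> n)"

(* Global balance equations of the jump process on X with rates q.  All jump rates used below are
   uniformly bounded and every state has finitely many successors, so the sums converge, there is no
   explosion, and global balance is invariance under the transition semigroup. *)
definition stationary :: "('s \<Rightarrow> 's \<Rightarrow> real) \<Rightarrow> 's set \<Rightarrow> 's pmf \<Rightarrow> bool" where
  "stationary q X \<pi> \<longleftrightarrow> set_pmf \<pi> \<subseteq> X \<and>
     (\<forall>y\<in>X. pmf \<pi> y * (\<Sum>\<^sub>\<infinity>x\<in>X - {y}. q y x) = (\<Sum>\<^sub>\<infinity>x\<in>X - {y}. pmf \<pi> x * q x y))"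

(* Cancel-on-completion.  A state lists the types of all jobs present, oldest first.  Server n works
   on its replica of the oldest compatible job; when that replica finishes, the job leaves. *)

type_synonym 'n coc_state = "'n set list"

definition coc_states :: "'n set set \<Rightarrow> 'n coc_state set" where
  "coc_states \<S> = {c. set c \<subseteq> \<S>}"

definition coc_arrival :: "'n set \<Rightarrow> 'n coc_state \<Rightarrow> 'n coc_state" where
  "coc_arrival S c = c @ [S]"

definition coc_completion :: "'n \<Rightarrow> 'n coc_state \<Rightarrow> 'n coc_state" where
  "coc_completion n c =
     (case List.extract (\<lambda>S. n \<in> S) c of None \<Rightarrow> c | Some (c1, S, c2) \<Rightarrow> c1 @ c2)"

definition coc_jobs :: "'n coc_state \<Rightarrow> 'n set \<Rightarrow> nat" where
  "coc_jobs c S = count_list c S"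

definition coc_stationary ::
    "('n::finite \<Rightarrow> real) \<Rightarrow> 'n set set \<Rightarrow> ('n set \<Rightarrow> real) \<Rightarrow> real \<Rightarrow> 'n coc_state pmf \<Rightarrow> bool" where
  "coc_stationary \<mu> \<S> p lam =
     stationary (jump_rate \<mu> \<S> p lam coc_arrival coc_completion) (coc_states \<S>)"

(* Cancel-on-start.  A state (c, u, s) consists of the types c of the waiting jobs (oldest first), the
   idle servers u (longest idle first) and the map s from each busy server to the type of the job it
   is serving.  The pair (c, u) is Markov on its own, but does not determine the number of jobs of
   each type in service; hence the component s. *)

type_synonym 'n cos_state = "'n set list \<times> 'n list \<times> ('n \<rightharpoonup> 'n set)"

definition cos_states :: "'n set set \<Rightarrow> 'n cos_state set" where
  "cos_states \<S> = {(c, u, s).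
     set c \<subseteq> \<S> \<and> distinct u \<and> (\<forall>S\<in>set c. S \<inter> set u = {}) \<and>
     dom s = - set u \<and> (\<forall>n S. s n = Some S \<longrightarrow> S \<in> \<S> \<and> n \<in> S)}"

fun cos_arrival :: "'n set \<Rightarrow> 'n cos_state \<Rightarrow> 'n cos_state" where
  "cos_arrival S (c, u, s) =
     (case List.extract (\<lambda>n. n \<in> S) u of
        None \<Rightarrow> (c @ [S], u, s)
      | Some (u1, n, u2) \<Rightarrow> (c, u1 @ u2, s(n \<mapsto> S)))"

fun cos_completion :: "'n \<Rightarrow> 'n cos_state \<Rightarrow> 'n cos_state" where
  "cos_completion n (c, u, s) =
     (if n \<in> set u then (c, u, s)
      else case List.extract (\<lambda>S. n \<in> S) c of
        None \<Rightarrow> (c, u @ [n], s(n := None))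
      | Some (c1, S, c2) \<Rightarrow> (c1 @ c2, u, s(n \<mapsto> S)))"

fun cos_jobs :: "'n cos_state \<Rightarrow> 'n set \<Rightarrow> nat" where
  "cos_jobs (c, u, s) S = count_list c S + card {n. s n = Some S}"

definition cos_stationary ::
    "('n::finite \<Rightarrow> real) \<Rightarrow> 'n set set \<Rightarrow> ('n set \<Rightarrow> real) \<Rightarrow> real \<Rightarrow> 'n cos_state pmf \<Rightarrow> bool" where
  "cos_stationary \<mu> \<S> p lam =
     stationary (jump_rate \<mu> \<S> p lam cos_arrival cos_completion) (cos_states \<S>)"

(* Vectors indexed by \<S>, embedded in the vectors indexed by all sets of servers by filling up
   with zeros. *)
definition type_vec :: "'n::finite set set \<Rightarrow> ('n set \<Rightarrow> real) \<Rightarrow> real ^ 'n set" where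
  "type_vec \<S> v = (\<chi> S. if S \<in> \<S> then v S else 0)"

definition weak_limit ::
    "('i \<Rightarrow> 'v::topological_space measure) \<Rightarrow> 'v measure \<Rightarrow> 'i filter \<Rightarrow> bool" where
  "weak_limit M L F \<longleftrightarrow>
     (\<forall>f :: 'v \<Rightarrow> real. continuous_on UNIV f \<and> bounded (range f) \<longrightarrow>
        ((\<lambda>i. \<integral>v. f v \<partial>M i) \<longlongrightarrow> (\<integral>v. f v \<partial>L)) F)"

definition scaled_queue_law ::
    "('n::finite \<Rightarrow> real) \<Rightarrow> 'n set set \<Rightarrow> real \<Rightarrow> ('s \<Rightarrow> 'n set \<Rightarrow> nat) \<Rightarrow> 's pmf \<Rightarrow>
     (real ^ 'n set) measure" where
  "scaled_queue_law \<mu> \<S> lam jobs \<pi> =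
     distr (measure_pmf \<pi>) borel
       (\<lambda>x. (1 - lam / avg_speed \<mu>) *\<^sub>R type_vec \<S> (\<lambda>S. real (jobs x S)))"

definition exp_times_vec :: "'n::finite set set \<Rightarrow> ('n set \<Rightarrow> real) \<Rightarrow> (real ^ 'n set) measure" where
  "exp_times_vec \<S> p =
     distr (density lborel (\<lambda>t. ennreal (exponential_density 1 t))) borel (\<lambda>t. t *\<^sub>R type_vec \<S> p)"

end

(* The product forms solve the balance equations of the queueing chains, and these chains have only
   one invariant law because all states lead to a common one.  Let F(T) be the total weight of the
   words in which exactly the types in T occur.  Splitting off the last letter gives
   (mu(T) - a(T)) F(T) = sum over S in T of a(S) F(T - {S}), where a(S) = N lam p(S) z(S) includes the
   argument z of the generating function.  With z(S) = exp(- (1 - lam/mu) k(S)), local stability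
   makes F(T) converge for all strict subsets T, whereas (1 - lam/mu) F(T) for the full set of types
   converges to const / (1 + sum of p(S) k(S)).  Hence the Laplace transforms of the scaled queue
   vector converge to that of Exp(1) p, and on the nonnegative orthant this implies weak convergence
   by Stone-Weierstrass in the variables exp(- x(S)). *)

theory Submission
  imports Defs
begin

section \<open>Laplace transforms on the nonnegative orthant\<close>

text \<open>Two obstacles shape the proof. Stone-Weierstrass handles functions that are continuous
  on the whole closed cube, whose faces y_j = 0 stand for infinity, but a bounded continuous
  function of the queue vector need not extend to these faces. A cutoff near them bridges this, and
  the convergence of the cutoff integrals itself supplies tightness. Monomials in exp(- x_j) have
  natural exponents, so Laplace transforms are evaluated at lattice points k only. The other
  obstacle is that the c.o.s. product form describes (c, u), while the job counts also involve the
  types in service. These are projected away; at most N jobs are in service, and the slack factor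
  makes them negligible. The term 1 + sum of p(S) k(S) has this origin: with M the total speed and e
  the slack, the denominator for the full set of types is M times the sum of p(S) (1 - (1 - e) exp(-
  e k(S))), whose linear coefficient in e is M (1 + sum of p(S) k(S)). Under c.o.s. an idle word
  compatible with some type excludes the full set of types, hence the divergent term, and the weight
  of the other idle words cancels in the normalized transform.\<close>

inductive_set monomial_sums :: "(real ^ 'k::finite \<Rightarrow> real) set" where
  monomial: "(\<lambda>y. c * (\<Prod>j\<in>UNIV. y $ j ^ k j)) \<in> monomial_sums"
| add: "f \<in> monomial_sums \<Longrightarrow> g \<in> monomial_sums \<Longrightarrow> (\<lambda>y. f y + g y) \<in> monomial_sums"

text \<open>Products are not a generating rule, so inductions over \<open>monomial_sums\<close> meet
  only monomials and sums, through which limits of Laplace transforms pass termwise. The ring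
  structure asked for by Stone-Weierstrass is recovered here by adding exponents.\<close>

lemma monomial_sums_mult:
  assumes "f \<in> monomial_sums" "g \<in> monomial_sums"
  shows "(\<lambda>y. f y * g y) \<in> monomial_sums"
  using assms
proof (induction f rule: monomial_sums.induct)
  case (monomial c k)
  from monomial show ?case
  proof (induction g rule: monomial_sums.induct)
    case (monomial d l)
    have "(\<lambda>y::real^'a. c * (\<Prod>j\<in>UNIV. y $ j ^ k j) * (d * (\<Prod>j\<in>UNIV. y $ j ^ l j)))
      = (\<lambda>y. (c * d) * (\<Prod>j\<in>UNIV. y $ j ^ (k j + l j)))"
      by (simp add: power_add prod.distrib mult_ac)
    then show ?case using monomial_sums.monomial[of "c * d" "\<lambda>j. k j + l j"] by simp
  next
    case (add f g)
    then show ?case using monomial_sums.add by (simp add: distrib_left)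
  qed
next
  case (add f1 f2)
  then show ?case using monomial_sums.add by (simp add: distrib_right)
qed

lemma continuous_on_monomial_sums:
  "f \<in> monomial_sums \<Longrightarrow> continuous_on S f"
  by (induction rule: monomial_sums.induct) (auto intro!: continuous_intros)

lemma monomial_sums_dense:
  fixes f :: "real ^ 'k::finite \<Rightarrow> real"
  assumes "compact S" "continuous_on S f" "e > 0"
  obtains g where "g \<in> monomial_sums" "\<And>x. x \<in> S \<Longrightarrow> \<bar>f x - g x\<bar> < e"
proof -
  have const: "(\<lambda>_. c) \<in> (monomial_sums :: (real ^ 'k \<Rightarrow> real) set)" for c
    using monomial_sums.monomial[of c "\<lambda>_. 0"] by simp
  have coord: "(\<lambda>y. y $ i) \<in> (monomial_sums :: (real ^ 'k \<Rightarrow> real) set)" for i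
  proof -
    have "(\<Prod>j\<in>UNIV. y $ j ^ (if j = i then 1 else 0)) = y $ i" for y :: "real ^ 'k"
      by (simp add: prod.remove[of UNIV i] cong: if_cong)
    then show ?thesis using monomial_sums.monomial[of 1 "\<lambda>j. if j = i then 1 else 0"] by simp
  qed
  interpret function_ring_on "monomial_sums :: (real ^ 'k \<Rightarrow> real) set" S
    by standard (use assms const coord in \<open>auto intro: monomial_sums_mult monomial_sums.add
      continuous_on_monomial_sums simp: vec_eq_iff\<close>)
  show thesis using Stone_Weierstrass_basic[OF assms(2,3)] that by blast
qed

text \<open>On the nonnegative orthant this is a homeomorphism onto the half-open cube (0,1]^k. The
  compact closure adds the faces where a coordinate is 0, which stand for infinity.\<close>

definition exp_neg_vec :: "real ^ 'k \<Rightarrow> real ^ 'k::finite" where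
  "exp_neg_vec x = (\<chi> j. exp (- x $ j))"

lemma continuous_on_exp_neg_vec [continuous_intros]: "continuous_on S exp_neg_vec"
  unfolding exp_neg_vec_def by (intro continuous_intros)

lemma exp_neg_vec_in_cube: "\<forall>j. 0 \<le> x $ j \<Longrightarrow> exp_neg_vec x \<in> cbox 0 1"
  by (simp add: exp_neg_vec_def mem_box_cart)

lemma prod_exp_neg_vec_power:
  "(\<Prod>j\<in>UNIV. exp_neg_vec x $ j ^ k j) = exp (- (\<Sum>j\<in>UNIV. real (k j) * x $ j))"
  by (simp add: exp_neg_vec_def exp_of_nat_mult[symmetric] exp_sum sum_negf[symmetric])

lemma abs_integral_diff_le:
  assumes "prob_space M" "integrable M f" "integrable M g" "AE x in M. \<bar>f x - g x\<bar> \<le> (e::real)"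
  shows "\<bar>(\<integral>x. f x \<partial>M) - (\<integral>x. g x \<partial>M)\<bar> \<le> e"
proof -
  interpret prob_space M by fact
  have "(\<integral>x. f x - g x \<partial>M) \<le> e" 
    by (rule integral_le_const) (use assms in \<open>auto elim: eventually_mono\<close>)
  moreover have "(\<integral>x. f x - g x \<partial>M) \<ge> - e"
    by (rule integral_ge_const) (use assms in \<open>auto elim: eventually_mono\<close>)
  ultimately show ?thesis using assms by (auto simp: Bochner_Integration.integral_diff)
qed

locale orthant_prob =
  fixes M :: "(real ^ 'k::finite) measure"
  assumes sets_M: "sets M = sets borel" and prob: "prob_space M"
    and orthant: "AE x in M. \<forall>j. 0 \<le> x $ j"
begin

sublocale prob_space M by (fact prob)

lemma measurable_continuous: "continuous_on UNIV f \<Longrightarrow> f \<in> borel_measurable M"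
  for f :: "real ^ 'k \<Rightarrow> real"
  using borel_measurable_continuous_onI[of f] measurable_cong_sets[OF sets_M refl] by blast

lemma AE_exp_neg_vec: "AE x in M. exp_neg_vec x \<in> cbox 0 1"
  using orthant by eventually_elim (rule exp_neg_vec_in_cube)

lemma integrable_exp_neg_vec:
  fixes f :: "real ^ 'k \<Rightarrow> real"
  assumes "continuous_on UNIV f"
  shows "integrable M (\<lambda>x. f (exp_neg_vec x))"
proof -
  have "compact (f ` cbox 0 1)"
    by (intro compact_continuous_image) (auto intro: continuous_on_subset[OF assms])
  then obtain B where "\<And>y. y \<in> cbox 0 1 \<Longrightarrow> \<bar>f y\<bar> \<le> B"
    using compact_imp_bounded[of "f ` cbox 0 1"] by (auto simp: bounded_iff)
  moreover have "continuous_on UNIV (\<lambda>x. f (exp_neg_vec x))"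
    by (rule continuous_on_compose2[OF assms]) (auto intro: continuous_intros)
  ultimately show ?thesis
    using AE_exp_neg_vec
    by (intro integrable_const_bound[where B=B]) (auto intro: measurable_continuous elim: eventually_mono)
qed

lemma integrable_bounded_continuous:
  "continuous_on UNIV f \<Longrightarrow> (\<And>x. \<bar>f x\<bar> \<le> B) \<Longrightarrow> integrable M f"
  for f :: "real ^ 'k \<Rightarrow> real"
  by (intro integrable_const_bound[where B=B]) (auto intro: measurable_continuous)

lemma integrable_monomial_sums:
  "f \<in> monomial_sums \<Longrightarrow> integrable M (\<lambda>x. f (exp_neg_vec x))"
  by (intro integrable_exp_neg_vec continuous_on_monomial_sums)

end

text \<open>For \<delta> > 0 the value is 1 where the product of the coordinates is at least 2
  \<delta>, and 0 where it is at most \<delta>. Subtracting 1 makes it vanish on the whole part of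
  the cube where some coordinate is at most \<delta>, not merely on the faces.\<close>

definition cutoff :: "real \<Rightarrow> real ^ 'k::finite \<Rightarrow> real" where
  "cutoff \<delta> y = min 1 (max 0 ((\<Prod>j\<in>UNIV. y $ j) / \<delta> - 1))"

lemma continuous_on_cutoff: "continuous_on S (cutoff \<delta>)"
  unfolding cutoff_def by (cases "\<delta> = 0") (auto intro!: continuous_intros)

lemma cutoff_bounds: "0 \<le> cutoff \<delta> y" "cutoff \<delta> y \<le> 1"
  by (auto simp: cutoff_def)

lemma cutoff_eq_0:
  assumes "0 < \<delta>" "y \<in> cbox 0 1" "y $ i \<le> \<delta>"
  shows "cutoff \<delta> y = 0"
proof -
  have y: "0 \<le> y $ j" "y $ j \<le> 1" for j
    using assms(2) by (auto simp: mem_box_cart)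
  have "(\<Prod>j\<in>UNIV. y $ j) = y $ i * (\<Prod>j\<in>UNIV - {i}. y $ j)"
    by (simp add: prod.remove)
  also have "\<dots> \<le> y $ i * 1"
    by (intro mult_left_mono prod_le_1) (use y in auto)
  finally show ?thesis using assms by (simp add: cutoff_def divide_simps)
qed

text \<open>A coordinate exp (- x_j) is never 0, so at each fixed x the cutoffs are eventually 1. By
  dominated convergence a single law leaves little mass near infinity.\<close>

lemma (in orthant_prob) cutoff_tendsto:
  "(\<lambda>n. \<integral>x. cutoff (1 / real (Suc n)) (exp_neg_vec x) \<partial>M) \<longlonglongrightarrow> 1"
proof -
  have "(\<lambda>n. \<integral>x. cutoff (1 / real (Suc n)) (exp_neg_vec x) \<partial>M) \<longlonglongrightarrow> (\<integral>x. 1 \<partial>M)"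
  proof (rule integral_dominated_convergence[where w="\<lambda>_. 1"])
    show "AE x in M. (\<lambda>n. cutoff (1 / real (Suc n)) (exp_neg_vec x)) \<longlonglongrightarrow> 1"
    proof (rule AE_I2)
      fix x :: "real ^ 'k"
      define m where "m = (\<Prod>j\<in>UNIV. exp_neg_vec x $ j)"
      have m: "m > 0" by (simp add: m_def exp_neg_vec_def prod_pos)
      have "eventually (\<lambda>n. real n \<ge> 2 / m) sequentially"
        using filterlim_real_sequentially by (auto simp: filterlim_at_top)
      then have "eventually (\<lambda>n. cutoff (1 / real (Suc n)) (exp_neg_vec x) = 1) sequentially"
      proof eventually_elim
        case (elim n)
        then have "m * real (Suc n) \<ge> 2" using m by (simp add: field_simps)
        then show ?case by (simp add: cutoff_def m_def[symmetric])
      qed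
      then show "(\<lambda>n. cutoff (1 / real (Suc n)) (exp_neg_vec x)) \<longlonglongrightarrow> 1"
        by (rule tendsto_eventually)
    qed
    show "(\<lambda>x. cutoff (1 / real (Suc n)) (exp_neg_vec x)) \<in> borel_measurable M" for n
      by (intro measurable_continuous continuous_on_compose2[OF continuous_on_cutoff])
        (auto intro: continuous_intros)
  qed (simp_all add: abs_of_nonneg cutoff_bounds)
  then show ?thesis by (simp add: prob_space)
qed

text \<open>Convergence spreads from monomials to \<open>monomial_sums\<close>, by uniform
  approximation to all continuous functions of the cube, and through a cutoff to bounded continuous
  functions on the orthant.\<close>

theorem weak_limit_laplaceI:
  fixes M :: "'i \<Rightarrow> (real ^ 'k::finite) measure"
  assumes M: "eventually (\<lambda>i. orthant_prob (M i)) F" and L: "orthant_prob L"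
    and lim: "\<And>k :: 'k \<Rightarrow> nat.
      ((\<lambda>i. \<integral>x. exp (- (\<Sum>j\<in>UNIV. real (k j) * x $ j)) \<partial>M i) \<longlongrightarrow>
        (\<integral>x. exp (- (\<Sum>j\<in>UNIV. real (k j) * x $ j)) \<partial>L)) F"
  shows "weak_limit M L F"
  unfolding weak_limit_def
proof (intro allI impI, elim conjE)
  interpret L: orthant_prob L by fact
  have lim_sums: "((\<lambda>i. \<integral>x. g (exp_neg_vec x) \<partial>M i) \<longlongrightarrow> (\<integral>x. g (exp_neg_vec x) \<partial>L)) F"
    if "g \<in> monomial_sums" for g
    using that
  proof induction
    case (monomial c k)
    show ?case unfolding prod_exp_neg_vec_power by (simp add: tendsto_mult_left lim)
  next
    case (add f g)
    have "eventually (\<lambda>i. (\<integral>x. f (exp_neg_vec x) \<partial>M i) + (\<integral>x. g (exp_neg_vec x) \<partial>M i)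
        = (\<integral>x. f (exp_neg_vec x) + g (exp_neg_vec x) \<partial>M i)) F"
      using M
    proof eventually_elim
      case (elim i)
      interpret orthant_prob "M i" by fact
      show ?case using add by (simp add: integrable_monomial_sums)
    qed
    with tendsto_add[OF add.IH] add show ?case
      by (simp add: L.integrable_monomial_sums tendsto_cong)
  qed
  have lim_cont: "((\<lambda>i. \<integral>x. g (exp_neg_vec x) \<partial>M i) \<longlongrightarrow> (\<integral>x. g (exp_neg_vec x) \<partial>L)) F"
    if g: "continuous_on UNIV g" for g :: "real ^ 'k \<Rightarrow> real"
  proof (rule tendstoI)
    fix e :: real assume "e > 0"
    then obtain h where h: "h \<in> monomial_sums" "\<And>x. x \<in> cbox 0 1 \<Longrightarrow> \<bar>g x - h x\<bar> < e / 3"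
      using monomial_sums_dense[of "cbox 0 1" g "e / 3"] continuous_on_subset[OF g] by auto
    have close: "\<bar>(\<integral>x. g (exp_neg_vec x) \<partial>N) - (\<integral>x. h (exp_neg_vec x) \<partial>N)\<bar> \<le> e / 3"
      if "orthant_prob N" for N
    proof -
      interpret orthant_prob N by fact
      show ?thesis
        by (rule abs_integral_diff_le)
          (use h g AE_exp_neg_vec in \<open>auto intro: integrable_exp_neg_vec integrable_monomial_sums
            prob_space_axioms less_imp_le elim!: eventually_mono\<close>)
    qed
    have "eventually (\<lambda>i. dist (\<integral>x. h (exp_neg_vec x) \<partial>M i) (\<integral>x. h (exp_neg_vec x) \<partial>L) < e / 3) F"
      using tendstoD[OF lim_sums[OF h(1)], of "e / 3"] \<open>e > 0\<close> by simp
    with M show "eventually (\<lambda>i. dist (\<integral>x. g (exp_neg_vec x) \<partial>M i) (\<integral>x. g (exp_neg_vec x) \<partial>L) < e) F"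
    proof eventually_elim
      case (elim i)
      then show ?case using close[OF elim(1)] close[OF L] unfolding dist_real_def by linarith
    qed
  qed
  fix f :: "real ^ 'k \<Rightarrow> real"
  assume f: "continuous_on UNIV f" "bounded (range f)"
  then obtain B where B: "\<And>x. \<bar>f x\<bar> \<le> B" by (auto simp: bounded_iff)
  then have B0: "B \<ge> 0" by (meson abs_ge_zero order_trans)
  show "((\<lambda>i. \<integral>x. f x \<partial>M i) \<longlongrightarrow> (\<integral>x. f x \<partial>L)) F"
  proof (rule tendstoI)
    fix e :: real assume e: "e > 0"
    \<comment> \<open>Two replacement errors of at most \<open>B * \<gamma>\<close> and one limit
      error below e / 4 must stay below e. The summand 1 keeps the denominator positive when B =
      0.\<close>
    define \<gamma> where "\<gamma> = e / (4 * (B + 1))"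
    have \<gamma>: "\<gamma> > 0" "B * \<gamma> < e / 4"
      using e B0 by (auto simp: \<gamma>_def field_simps)
    have "eventually (\<lambda>n. (\<integral>x. cutoff (1 / real (Suc n)) (exp_neg_vec x) \<partial>L) > 1 - \<gamma>) sequentially"
      using L.cutoff_tendsto \<gamma> by (intro order_tendstoD) auto
    then obtain n where "(\<integral>x. cutoff (1 / real (Suc n)) (exp_neg_vec x) \<partial>L) > 1 - \<gamma>"
      by (auto dest!: eventually_happens)
    then obtain \<delta> where \<delta>: "\<delta> > 0" "(\<integral>x. cutoff \<delta> (exp_neg_vec x) \<partial>L) > 1 - \<gamma>"
      using that[of "1 / real (Suc n)"] by simp
    \<comment> \<open>\<open>max\<close> keeps the logarithm continuous up to the faces. Where it
      alters a coordinate of a point of the cube, the cutoff vanishes, so g after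
      \<open>exp_neg_vec\<close> agrees on the orthant with f times the cutoff.\<close>
    define g where "g y = f (\<chi> j. - ln (max (y $ j) \<delta>)) * cutoff \<delta> y" for y
    have "continuous_on UNIV (\<lambda>y::real^'k. \<chi> j. - ln (max (y $ j) \<delta>))"
    proof (intro continuous_on_vec_lambda continuous_on_minus continuous_on_ln ballI)
      show "continuous_on UNIV (\<lambda>y::real^'k. max (y $ j) \<delta>)" for j
        by (intro continuous_on_max continuous_intros)
      show "max (y $ j) \<delta> \<noteq> 0" for y :: "real ^ 'k" and j
        using \<delta>(1) by (simp add: max_def)
    qed
    then have g: "continuous_on UNIV g"
      unfolding g_def using \<delta>
      by (intro continuous_on_mult continuous_on_cutoff continuous_on_compose2[OF f(1)]) auto
    have g_eq: "g (exp_neg_vec x) = f x * cutoff \<delta> (exp_neg_vec x)" if "\<forall>j. 0 \<le> x $ j" for x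
    proof (cases "\<forall>j. exp_neg_vec x $ j \<ge> \<delta>")
      case True
      then have "(\<chi> j. - ln (max (exp_neg_vec x $ j) \<delta>)) = x"
        by (simp add: vec_eq_iff max_absorb1) (simp add: exp_neg_vec_def)
      then show ?thesis by (simp add: g_def)
    next
      case False
      then obtain i where "exp_neg_vec x $ i \<le> \<delta>" by (auto simp: not_le intro: less_imp_le)
      then have "cutoff \<delta> (exp_neg_vec x) = 0"
        by (rule cutoff_eq_0[OF \<delta>(1) exp_neg_vec_in_cube[OF that]])
      then show ?thesis by (simp add: g_def)
    qed
    have close: "\<bar>(\<integral>x. f x \<partial>N) - (\<integral>x. g (exp_neg_vec x) \<partial>N)\<bar> \<le> B * \<gamma>"
      if "orthant_prob N" and low: "(\<integral>x. cutoff \<delta> (exp_neg_vec x) \<partial>N) > 1 - \<gamma>" for N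
    proof -
      interpret orthant_prob N by fact
      have int: "integrable N f" "integrable N (\<lambda>x. g (exp_neg_vec x))"
        "integrable N (\<lambda>x. cutoff \<delta> (exp_neg_vec x))"
        using f B g by (auto intro!: integrable_exp_neg_vec integrable_bounded_continuous continuous_on_cutoff)
      have "\<bar>(\<integral>x. f x \<partial>N) - (\<integral>x. g (exp_neg_vec x) \<partial>N)\<bar> = \<bar>\<integral>x. f x - g (exp_neg_vec x) \<partial>N\<bar>"
        using int by simp
      also have "\<dots> \<le> (\<integral>x. \<bar>f x - g (exp_neg_vec x)\<bar> \<partial>N)"
        by (rule integral_abs_bound)
      also have "\<dots> \<le> (\<integral>x. B * (1 - cutoff \<delta> (exp_neg_vec x)) \<partial>N)"
      proof (rule integral_mono_AE)
        show "AE x in N. \<bar>f x - g (exp_neg_vec x)\<bar> \<le> B * (1 - cutoff \<delta> (exp_neg_vec x))"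
          using orthant
        proof eventually_elim
          case (elim x)
          have "\<bar>f x - g (exp_neg_vec x)\<bar> = \<bar>f x\<bar> * (1 - cutoff \<delta> (exp_neg_vec x))"
          proof -
            have "f x - g (exp_neg_vec x) = f x * (1 - cutoff \<delta> (exp_neg_vec x))"
              by (simp add: g_eq[OF elim] right_diff_distrib)
            then show ?thesis using cutoff_bounds(2)[of \<delta> "exp_neg_vec x"] by (simp add: abs_mult)
          qed
          then show ?case using B cutoff_bounds(2)[of \<delta> "exp_neg_vec x"] by (simp add: mult_right_mono)
        qed
      qed (use int in auto)
      also have "\<dots> = B * (1 - (\<integral>x. cutoff \<delta> (exp_neg_vec x) \<partial>N))"
        using int by (simp add: prob_space)
      also have "\<dots> \<le> B * \<gamma>" using low B0 by (intro mult_left_mono) auto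
      finally show ?thesis .
    qed
    \<comment> \<open>The cutoff is itself continuous on the cube, so its integrals converge and the
      lower bound at L passes to the laws \<open>M i\<close>. This is their tightness.\<close>
    have "eventually (\<lambda>i. (\<integral>x. cutoff \<delta> (exp_neg_vec x) \<partial>M i) > 1 - \<gamma>) F"
      using lim_cont[OF continuous_on_cutoff] \<delta>(2) by (rule order_tendstoD)
    moreover have "eventually (\<lambda>i. dist (\<integral>x. g (exp_neg_vec x) \<partial>M i) (\<integral>x. g (exp_neg_vec x) \<partial>L) < e / 4) F"
      using tendstoD[OF lim_cont[OF g], of "e / 4"] e by simp
    ultimately show "eventually (\<lambda>i. dist (\<integral>x. f x \<partial>M i) (\<integral>x. f x \<partial>L) < e) F"
      using M
    proof eventually_elim
      case (elim i)
      then show ?case using close[OF elim(3,1)] close[OF L \<delta>(2)] \<gamma>(2) unfolding dist_real_def by linarith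
    qed
  qed
qed

section \<open>Invariant laws of event-driven chains\<close>

text \<open>One step draws an event from E, independently of the state, and applies its
  deterministic update. In this form lumping and preimage arguments are direct.\<close>

definition invariant_pmf :: "'e pmf \<Rightarrow> ('e \<Rightarrow> 's \<Rightarrow> 's) \<Rightarrow> 's pmf \<Rightarrow> bool" where
  "invariant_pmf E act \<pi> \<longleftrightarrow> \<pi> = bind_pmf E (\<lambda>e. map_pmf (act e) \<pi>)"

text \<open>Lumping: since h commutes with every event, the image evolves as a chain of its own.
  This is how the served job types of cancel-on-start are projected away.\<close>

lemma invariant_pmf_map:
  assumes "invariant_pmf E act \<pi>" and "\<And>e x. h (act e x) = act' e (h x)"
  shows "invariant_pmf E act' (map_pmf h \<pi>)"
proof -
  have "map_pmf h \<pi> = map_pmf h (bind_pmf E (\<lambda>e. map_pmf (act e) \<pi>))"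
    using assms(1) by (simp add: invariant_pmf_def)
  also have "\<dots> = bind_pmf E (\<lambda>e. map_pmf (act' e) (map_pmf h \<pi>))"
    by (simp add: map_bind_pmf map_pmf_comp assms(2))
  finally show ?thesis by (simp add: invariant_pmf_def)
qed

lemma measure_invariant_pmf:
  assumes "invariant_pmf E act \<pi>" and "finite (set_pmf E)"
  shows "measure_pmf.prob \<pi> A = (\<Sum>e\<in>set_pmf E. pmf E e * measure_pmf.prob \<pi> (act e -` A))"
proof -
  have "measure_pmf.prob \<pi> A = measure_pmf.prob (bind_pmf E (\<lambda>e. map_pmf (act e) \<pi>)) A"
    using assms(1) by (simp add: invariant_pmf_def)
  also have "\<dots> = (\<integral>e. measure_pmf.prob \<pi> (act e -` A) \<partial>E)"
    unfolding measure_pmf_bind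
    by (subst measure_pmf.measure_bind[where N="count_space UNIV"])
      (auto simp: measurable_def space_subprob_algebra prob_space_imp_subprob_space
        measure_pmf.prob_space_axioms)
  also have "\<dots> = (\<Sum>e\<in>set_pmf E. pmf E e * measure_pmf.prob \<pi> (act e -` A))"
    using assms(2) by (subst integral_measure_pmf) auto
  finally show ?thesis .
qed

lemma prob_mono_pmf:
  assumes "\<And>x. x \<in> C \<Longrightarrow> pmf \<pi> x \<le> pmf \<nu> x"
  shows "measure_pmf.prob \<pi> C \<le> measure_pmf.prob \<nu> C"
  unfolding measure_pmf_conv_infsetsum
  using assms by (intro infsetsum_mono) (auto intro: pmf_abs_summable)

lemma prob_strict_mono_pmf:
  assumes "\<And>x. x \<in> C \<Longrightarrow> pmf \<pi> x \<le> pmf \<nu> x" "c \<in> C" "pmf \<pi> c < pmf \<nu> c"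
  shows "measure_pmf.prob \<pi> C < measure_pmf.prob \<nu> C"
proof -
  have split: "measure_pmf.prob \<rho> C = pmf \<rho> c + measure_pmf.prob \<rho> (C - {c})" for \<rho> :: "'a pmf"
    using measure_pmf.finite_measure_Union[where M=\<rho> and A="{c}" and B="C - {c}"] assms(2)
    by (simp add: insert_absorb measure_pmf_single)
  have "measure_pmf.prob \<pi> (C - {c}) \<le> measure_pmf.prob \<nu> (C - {c})"
    using assms(1) by (intro prob_mono_pmf) auto
  then show ?thesis using assms(3) split[of \<pi>] split[of \<nu>] by simp
qed

text \<open>The set where one invariant law exceeds the other maximizes the difference of the two laws,
  and invariance writes this maximum as an average over its preimages, so all of these are
  maximizers too.\<close>

lemma invariant_pmf_excess_closed:
  assumes inv: "invariant_pmf E act \<pi>" "invariant_pmf E act \<nu>" and fin: "finite (set_pmf E)"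
    and e: "e \<in> set_pmf E" and a: "pmf \<nu> a < pmf \<pi> a"
  shows "pmf \<nu> (act e a) < pmf \<pi> (act e a)"
proof (rule ccontr)
  define A where "A = {x. pmf \<nu> x < pmf \<pi> x}"
  define d where "d B = measure_pmf.prob \<pi> B - measure_pmf.prob \<nu> B" for B
  have d_split: "d B = d (B \<inter> C) + d (B - C)" for B C
    using measure_pmf.finite_measure_Union[where A="B \<inter> C" and B="B - C"]
    by (auto simp: d_def Int_Diff_Un Int_Diff_disjoint)
  have d_out: "d (B - A) \<le> 0" for B
    unfolding d_def using prob_mono_pmf[of "B - A" \<pi> \<nu>] by (auto simp: A_def)
  have d_in: "d (A - B) \<ge> 0" for B
    unfolding d_def using prob_mono_pmf[of "A - B" \<nu> \<pi>] by (auto simp: A_def)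
  have d_le: "d B \<le> d A" for B
    using d_split[of B A] d_split[of A B] d_out[of B] d_in[of B] by (simp add: Int_commute)
  assume "\<not> ?thesis"
  then have "a \<in> A - act e -` A" using a by (auto simp: A_def)
  then have "d (A - act e -` A) > 0"
    unfolding d_def using prob_strict_mono_pmf[of "A - act e -` A" \<nu> \<pi> a] by (auto simp: A_def)
  then have lt: "d (act e -` A) < d A"
    using d_split[of "act e -` A" A] d_split[of A "act e -` A"] d_out[of "act e -` A"]
    by (simp add: Int_commute)
  have "d A = (\<Sum>e\<in>set_pmf E. pmf E e * d (act e -` A))"
    unfolding d_def measure_invariant_pmf[OF inv(1) fin, of A] measure_invariant_pmf[OF inv(2) fin, of A]
    by (simp add: sum_subtractf right_diff_distrib)
  also have "\<dots> < (\<Sum>e\<in>set_pmf E. pmf E e * d A)"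
    using fin e lt d_le by (intro sum_strict_mono_ex1) (auto simp: pmf_positive intro!: mult_left_mono)
  also have "\<dots> = d A" using fin by (simp add: sum_distrib_right[symmetric] sum_pmf_eq_1)
  finally show False by simp
qed

text \<open>\<open>further\<close> prepends the first event of the path, so induction carries a
  property preserved by all events from x forward to z.\<close>

inductive reaches :: "'e set \<Rightarrow> ('e \<Rightarrow> 's \<Rightarrow> 's) \<Rightarrow> 's \<Rightarrow> 's \<Rightarrow> bool" for E act z where
  here: "reaches E act z z"
| further: "e \<in> E \<Longrightarrow> reaches E act z (act e x) \<Longrightarrow> reaches E act z x"

text \<open>If each law exceeded the other somewhere, closure of the excess under events would carry
  both excesses to z, which is absurd. So one law dominates the other pointwise, and equal total
  mass makes them equal.\<close>

lemma invariant_pmf_unique: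
  assumes inv: "invariant_pmf E act \<pi>" "invariant_pmf E act \<nu>" and fin: "finite (set_pmf E)"
    and reach: "\<And>x. x \<in> set_pmf \<pi> \<union> set_pmf \<nu> \<Longrightarrow> reaches (set_pmf E) act z x"
  shows "\<pi> = \<nu>"
proof -
  have excess: "pmf \<sigma> z < pmf \<rho> z"
    if "invariant_pmf E act \<rho>" "invariant_pmf E act \<sigma>" "reaches (set_pmf E) act z x"
      "pmf \<sigma> x < pmf \<rho> x" for \<rho> \<sigma> x
    using that(3,4) by induction (auto dest: invariant_pmf_excess_closed[OF that(1,2) fin])
  have mem: "x \<in> set_pmf \<rho>" if "pmf \<sigma> x < pmf \<rho> x" for \<rho> \<sigma> :: "'b pmf" and x
    using that pmf_nonneg[of \<sigma> x] by (auto simp: set_pmf_iff)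
  have le: "(\<forall>x. pmf \<pi> x \<le> pmf \<nu> x) \<or> (\<forall>x. pmf \<nu> x \<le> pmf \<pi> x)"
  proof (rule ccontr)
    assume "\<not> ?thesis"
    then obtain x y where xy: "pmf \<nu> x < pmf \<pi> x" "pmf \<pi> y < pmf \<nu> y" by (auto simp: not_le)
    then have "pmf \<nu> z < pmf \<pi> z" "pmf \<pi> z < pmf \<nu> z"
      using excess[OF inv, of x] excess[OF inv(2,1), of y] reach mem by auto
    then show False by simp
  qed
  have eq: "\<rho> = \<sigma>" if "\<forall>x. pmf \<rho> x \<le> pmf \<sigma> x" for \<rho> \<sigma> :: "'b pmf"
  proof (rule pmf_eqI)
    fix x
    have "measure_pmf.prob \<rho> UNIV = measure_pmf.prob \<sigma> UNIV"
      using measure_pmf.prob_space[of \<rho>] measure_pmf.prob_space[of \<sigma>] by simp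
    then have "\<not> pmf \<rho> x < pmf \<sigma> x"
      using prob_strict_mono_pmf[of UNIV \<rho> \<sigma> x] that by auto
    then show "pmf \<rho> x = pmf \<sigma> x" using that by (simp add: order.antisym not_less)
  qed
  show ?thesis using le eq[of \<pi> \<nu>] eq[of \<nu> \<pi>] by auto
qed

section \<open>Uniformization: from balance equations to a chain of potential events\<close>

text \<open>Adding the self-loops to both sides of the balance equations turns stationarity of the jump
  process into invariance under the chain of potential events.\<close>

definition total_rate :: "('n::finite \<Rightarrow> real) \<Rightarrow> 'n set set \<Rightarrow> ('n set \<Rightarrow> real) \<Rightarrow> real \<Rightarrow> real" where
  "total_rate \<mu> \<S> p lam = (\<Sum>S\<in>\<S>. real CARD('n) * lam * p S) + (\<Sum>n\<in>UNIV. \<mu> n)"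

definition event_prob :: "('n::finite \<Rightarrow> real) \<Rightarrow> 'n set set \<Rightarrow> ('n set \<Rightarrow> real) \<Rightarrow> real \<Rightarrow>
    'n set + 'n \<Rightarrow> real" where
  "event_prob \<mu> \<S> p lam e =
    (case e of Inl S \<Rightarrow> if S \<in> \<S> then real CARD('n) * lam * p S else 0 | Inr n \<Rightarrow> \<mu> n)
      / total_rate \<mu> \<S> p lam"

definition event_pmf :: "('n::finite \<Rightarrow> real) \<Rightarrow> 'n set set \<Rightarrow> ('n set \<Rightarrow> real) \<Rightarrow> real \<Rightarrow>
    ('n set + 'n) pmf" where
  "event_pmf \<mu> \<S> p lam = embed_pmf (event_prob \<mu> \<S> p lam)"

lemma has_sum_sum:
  fixes f :: "'i \<Rightarrow> 'a \<Rightarrow> 'b::{topological_comm_monoid_add}"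
  assumes "finite I" "\<And>i. i \<in> I \<Longrightarrow> (f i has_sum s i) A"
  shows "((\<lambda>x. \<Sum>i\<in>I. f i x) has_sum (\<Sum>i\<in>I. s i)) A"
  using assms by (induction rule: finite_induct) (auto intro: has_sum_add)

lemma nn_integral_count_space_has_sum:
  assumes "(f has_sum s) UNIV" "\<And>x. 0 \<le> f x"
  shows "(\<integral>\<^sup>+x. ennreal (f x) \<partial>count_space UNIV) = ennreal s"
proof -
  have *: "(\<lambda>x. norm (f x)) summable_on UNIV"
    using assms by (auto simp: summable_on_iff_abs_summable_on_real[symmetric]
      intro: has_sum_imp_summable)
  then have abs: "Infinite_Set_Sum.abs_summable_on f UNIV"
    using abs_summable_equivalent by blast
  then have "(\<integral>\<^sup>+x. ennreal (f x) \<partial>count_space UNIV) = ennreal (infsetsum f UNIV)"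
    using assms(2) by (simp add: nn_integral_conv_infsetsum)
  also have "infsetsum f UNIV = s"
    using infsetsum_infsum[OF abs] assms(1) by (simp add: infsumI)
  finally show ?thesis .
qed

locale queue_rates =
  fixes \<mu> :: "'n::finite \<Rightarrow> real" and \<S> :: "'n set set" and p :: "'n set \<Rightarrow> real" and lam :: real
  assumes \<mu>_pos: "0 < \<mu> n" and p_pos: "S \<in> \<S> \<Longrightarrow> 0 < p S" and lam_pos: "0 < lam"
begin

abbreviation "\<Lambda> \<equiv> total_rate \<mu> \<S> p lam"
abbreviation "arr_rate S \<equiv> real CARD('n) * lam * p S"

lemma arrival_rate_pos: "S \<in> \<S> \<Longrightarrow> 0 < arr_rate S"
  using p_pos lam_pos by simp

lemma total_rate_pos: "0 < \<Lambda>"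
proof -
  have "0 < (\<Sum>n\<in>UNIV. \<mu> n)" using \<mu>_pos by (intro sum_pos) auto
  moreover have "0 \<le> (\<Sum>S\<in>\<S>. arr_rate S)" using arrival_rate_pos by (intro sum_nonneg less_imp_le) auto
  ultimately show ?thesis by (simp add: total_rate_def)
qed

lemma pmf_event_pmf: "pmf (event_pmf \<mu> \<S> p lam) e = event_prob \<mu> \<S> p lam e"
  unfolding event_pmf_def
proof (rule pmf_embed_pmf)
  show nonneg: "0 \<le> event_prob \<mu> \<S> p lam e" for e
    using total_rate_pos \<mu>_pos[THEN less_imp_le] arrival_rate_pos[THEN less_imp_le]
    by (auto simp: event_prob_def split: sum.split)
  have "(\<Sum>e\<in>UNIV. event_prob \<mu> \<S> p lam e) = 1"
    using total_rate_pos
    by (simp add: UNIV_Plus_UNIV[symmetric] sum.Plus event_prob_def sum_divide_distrib[symmetric]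
        add_divide_distrib[symmetric] total_rate_def sum.If_cases del: UNIV_Plus_UNIV)
  then show "(\<integral>\<^sup>+e. ennreal (event_prob \<mu> \<S> p lam e) \<partial>count_space UNIV) = 1"
    using nonneg by (subst nn_integral_count_space_has_sum[where s=1]) (auto intro: has_sum_finiteI)
qed

lemma set_event_pmf: "set_pmf (event_pmf \<mu> \<S> p lam) = Inl ` \<S> \<union> range Inr"
proof (intro set_eqI)
  show "e \<in> set_pmf (event_pmf \<mu> \<S> p lam) \<longleftrightarrow> e \<in> Inl ` \<S> \<union> range Inr" for e
    using total_rate_pos less_imp_neq[OF \<mu>_pos] less_imp_neq[OF arrival_rate_pos]
    by (cases e) (auto simp: set_pmf_iff pmf_event_pmf event_prob_def)
qed

lemma invariant_event_pmf_iff: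
  "invariant_pmf (event_pmf \<mu> \<S> p lam) (case_sum arr dep) \<pi> \<longleftrightarrow>
    (\<forall>y. \<Lambda> * pmf \<pi> y = (\<Sum>S\<in>\<S>. arr_rate S * measure_pmf.prob \<pi> (arr S -` {y}))
      + (\<Sum>n\<in>UNIV. \<mu> n * measure_pmf.prob \<pi> (dep n -` {y})))"
proof -
  have "\<Lambda> * pmf (bind_pmf (event_pmf \<mu> \<S> p lam) (\<lambda>e. map_pmf (case_sum arr dep e) \<pi>)) y =
      (\<Sum>S\<in>\<S>. arr_rate S * measure_pmf.prob \<pi> (arr S -` {y}))
      + (\<Sum>n\<in>UNIV. \<mu> n * measure_pmf.prob \<pi> (dep n -` {y}))" for y
  proof -
    have "\<Lambda> * pmf (bind_pmf (event_pmf \<mu> \<S> p lam) (\<lambda>e. map_pmf (case_sum arr dep e) \<pi>)) y =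
       (\<Sum>e\<in>UNIV. \<Lambda> * event_prob \<mu> \<S> p lam e * measure_pmf.prob \<pi> (case_sum arr dep e -` {y}))"
      by (simp add: pmf_bind integral_measure_pmf[of UNIV] pmf_event_pmf pmf_map
        sum_distrib_left mult.assoc)
    also have "\<dots> = (\<Sum>S\<in>\<S>. arr_rate S * measure_pmf.prob \<pi> (arr S -` {y}))
      + (\<Sum>n\<in>UNIV. \<mu> n * measure_pmf.prob \<pi> (dep n -` {y}))"
      using total_rate_pos
      by (simp add: UNIV_Plus_UNIV[symmetric] sum.Plus event_prob_def if_distrib if_distribR
        sum.If_cases del: UNIV_Plus_UNIV cong: if_cong)
    finally show ?thesis .
  qed
  moreover have "invariant_pmf (event_pmf \<mu> \<S> p lam) (case_sum arr dep) \<pi> \<longleftrightarrow>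
    (\<forall>y. \<Lambda> * pmf \<pi> y =
      \<Lambda> * pmf (bind_pmf (event_pmf \<mu> \<S> p lam) (\<lambda>e. map_pmf (case_sum arr dep e) \<pi>)) y)"
    using total_rate_pos by (auto simp: invariant_pmf_def pmf_eq_iff)
  ultimately show ?thesis by simp
qed

lemma stationary_imp_invariant:
  assumes st: "stationary (jump_rate \<mu> \<S> p lam arr dep) X \<pi>"
    and arr: "\<And>S x. S \<in> \<S> \<Longrightarrow> x \<in> X \<Longrightarrow> arr S x \<in> X"
    and dep: "\<And>n x. x \<in> X \<Longrightarrow> dep n x \<in> X"
  shows "invariant_pmf (event_pmf \<mu> \<S> p lam) (case_sum arr dep) \<pi>"
  unfolding invariant_event_pmf_iff
proof
  fix y
  let ?q = "jump_rate \<mu> \<S> p lam arr dep"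
  have X: "set_pmf \<pi> \<subseteq> X" using st by (simp add: stationary_def)
  have q: "?q x y = (\<Sum>S\<in>\<S>. arr_rate S * of_bool (arr S x = y)) + (\<Sum>n\<in>UNIV. \<mu> n * of_bool (dep n x = y))"
    for x y
    by (simp add: jump_rate_def of_bool_def if_distrib sum.If_cases Int_def cong: if_cong)
  show "\<Lambda> * pmf \<pi> y = (\<Sum>S\<in>\<S>. arr_rate S * measure_pmf.prob \<pi> (arr S -` {y}))
      + (\<Sum>n\<in>UNIV. \<mu> n * measure_pmf.prob \<pi> (dep n -` {y}))"
  proof (cases "y \<in> X")
    \<comment> \<open>No event leads out of X, so a state outside X carries no mass and receives
      none.\<close>
    case False
    have "measure_pmf.prob \<pi> (arr S -` {y}) = 0" if "S \<in> \<S>" for S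
      using that arr X False by (auto simp: measure_pmf_zero_iff)
    moreover have "measure_pmf.prob \<pi> (dep n -` {y}) = 0" for n
      using dep X False by (auto simp: measure_pmf_zero_iff)
    moreover have "pmf \<pi> y = 0" using False X by (auto simp: set_pmf_iff)
    ultimately show ?thesis by simp
  next
    case True
    have single: "((\<lambda>x. c * of_bool (t = x)) has_sum c) X" if "t \<in> X" for c :: real and t
      by (rule has_sum_finite_neutralI[where B="{t}"]) (use that in auto)
    \<comment> \<open>With self-loops included, the rates out of any state of X add up to \<Lambda>;
      removing the term at y leaves the outflow in the balance equation. The inflow is treated alike
      below, and the two self-loop terms cancel.\<close>
    have total: "(?q y has_sum (\<Sum>S\<in>\<S>. arr_rate S) + (\<Sum>n\<in>UNIV. \<mu> n)) X"
      unfolding q using True arr dep by (intro has_sum_add has_sum_sum single) auto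
    have out: "(?q y has_sum \<Lambda> - ?q y y) (X - {y})"
      unfolding total_rate_def using True by (intro has_sum_Diff[OF total] has_sum_finiteI) auto
    have mass: "((\<lambda>x. pmf \<pi> x * (c * of_bool (h x = y))) has_sum c * measure_pmf.prob \<pi> (h -` {y})) X"
      for c and h
    proof -
      have "(pmf \<pi> has_sum measure_pmf.prob \<pi> (h -` {y})) (h -` {y})"
      proof -
        have abs: "Infinite_Set_Sum.abs_summable_on (pmf \<pi>) (h -` {y})" by (rule pmf_abs_summable)
        then have "(\<lambda>x. norm (pmf \<pi> x)) summable_on (h -` {y})"
          using abs_summable_equivalent by blast
        then have "pmf \<pi> summable_on (h -` {y})" by simp
        then show ?thesis
          using infsetsum_infsum[OF abs] by (simp add: measure_pmf_conv_infsetsum)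
      qed
      then have "((\<lambda>x. c * pmf \<pi> x) has_sum c * measure_pmf.prob \<pi> (h -` {y})) (h -` {y})"
        by (rule has_sum_cmult_right)
      then show ?thesis
        by (rule has_sum_cong_neutral[THEN iffD1, rotated -1]) (use X in \<open>auto simp: set_pmf_iff\<close>)
    qed
    have total_in: "((\<lambda>x. pmf \<pi> x * ?q x y) has_sum (\<Sum>S\<in>\<S>. arr_rate S * measure_pmf.prob \<pi> (arr S -` {y}))
      + (\<Sum>n\<in>UNIV. \<mu> n * measure_pmf.prob \<pi> (dep n -` {y}))) X"
      unfolding q distrib_left sum_distrib_left by (intro has_sum_add has_sum_sum mass) auto
    have inflow: "((\<lambda>x. pmf \<pi> x * ?q x y) has_sum (\<Sum>S\<in>\<S>. arr_rate S * measure_pmf.prob \<pi> (arr S -` {y}))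
      + (\<Sum>n\<in>UNIV. \<mu> n * measure_pmf.prob \<pi> (dep n -` {y})) - pmf \<pi> y * ?q y y) (X - {y})"
      using True by (intro has_sum_Diff[OF total_in] has_sum_finiteI) auto
    have "pmf \<pi> y * (\<Sum>\<^sub>\<infinity>x\<in>X - {y}. ?q y x) = (\<Sum>\<^sub>\<infinity>x\<in>X - {y}. pmf \<pi> x * ?q x y)"
      using st True by (simp add: stationary_def)
    then show ?thesis
      unfolding infsumI[OF out] infsumI[OF inflow] by (simp add: algebra_simps)
  qed
qed

end

section \<open>Product-form weights of words\<close>

text \<open>Both factors of the c.o.s. product form are instances. For waiting words, a is the
  arrival rate and r the speed compatible with a set of types; for idle words, a is the speed and r
  the arrival rate compatible with a set of servers.\<close>

definition weight :: "('a \<Rightarrow> real) \<Rightarrow> ('a set \<Rightarrow> real) \<Rightarrow> 'a list \<Rightarrow> real" where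
  "weight a r c = (\<Prod>i<length c. a (c ! i) / r (set (take (Suc i) c)))"

lemma weight_Nil [simp]: "weight a r [] = 1"
  by (simp add: weight_def)

lemma weight_snoc: "weight a r (c @ [x]) = weight a r c * (a x / r (insert x (set c)))"
proof -
  have "(\<Prod>i<length c. a ((c @ [x]) ! i) / r (set (take (Suc i) (c @ [x]))))
      = (\<Prod>i<length c. a (c ! i) / r (set (take (Suc i) c)))"
    by (intro prod.cong) (auto simp: nth_append)
  then show ?thesis by (simp add: weight_def)
qed

lemma weight_pos:
  assumes "\<And>x. x \<in> set c \<Longrightarrow> 0 < a x" "\<And>A. A \<noteq> {} \<Longrightarrow> 0 < r A"
  shows "0 < weight a r c"
  unfolding weight_def by (intro prod_pos divide_pos_pos ballI assms) auto

lemma weight_mult: "weight (\<lambda>x. a x * z x) r c = weight a r c * prod_list (map z c)"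
  by (induction c rule: rev_induct) (auto simp: weight_snoc)

text \<open>Only the last letter of y can have just been appended, and cancelling its factor in
  \<open>weight_snoc\<close> leaves \<open>r (set y)\<close>. The condition \<open>r {} = 0\<close>
  covers the empty word, which has no predecessor.\<close>

lemma weight_snoc_balance:
  assumes "finite I" "set y \<subseteq> I" "r {} = 0" "y \<noteq> [] \<Longrightarrow> r (set y) \<noteq> 0"
  shows "(\<Sum>x\<in>I. a x * (\<Sum>d | y = d @ [x]. weight a r d)) = r (set y) * weight a r y"
proof (cases y rule: rev_cases)
  case Nil
  then show ?thesis using assms(3) by simp
next
  case (snoc e t)
  have "{d. y = d @ [x]} = (if x = t then {e} else {})" for x
    unfolding snoc by auto
  then have "(\<Sum>x\<in>I. a x * (\<Sum>d | y = d @ [x]. weight a r d)) =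
      (\<Sum>x\<in>I. if x = t then a t * weight a r e else 0)"
    by (intro sum.cong refl) simp
  also have "\<dots> = a t * weight a r e" using assms(1,2) snoc by simp
  also have "\<dots> = r (set y) * weight a r y" using assms(4) snoc by (simp add: weight_snoc)
  finally show ?thesis .
qed

text \<open>The coefficient is the extra rate that x brings behind the first j letters. Induction is
  on the last letter t: let q and R be the rates of all letters without and with x. Relative to
  \<open>a x * a t * weight a r d\<close>, the insertions before t give 1 / R and the one behind t
  gives (R - q) / (q R), and these add up to 1 / q.\<close>

lemma weight_insertion:
  assumes "r {} = 0" and "\<And>A. A \<noteq> {} \<Longrightarrow> A \<subseteq> insert x (set c) \<Longrightarrow> r A \<noteq> 0"
  shows "(\<Sum>j\<le>length c. (r (insert x (set (take j c))) - r (set (take j c))) *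
      weight a r (take j c @ x # drop j c)) = a x * weight a r c"
  using assms(2)
proof (induction c rule: rev_induct)
  case Nil
  then show ?case using assms(1) weight_snoc[of a r "[]" x] by simp
next
  case (snoc t d)
  define R where "R = r (insert x (insert t (set d)))"
  define q where "q = r (insert t (set d))"
  have nz: "R \<noteq> 0" "q \<noteq> 0"
    unfolding R_def q_def by (intro snoc.prems; force)+
  have IH: "(\<Sum>j\<le>length d. (r (insert x (set (take j d))) - r (set (take j d))) *
      weight a r (take j d @ x # drop j d)) = a x * weight a r d"
    using snoc.prems by (intro snoc.IH) auto
  \<comment> \<open>Wherever x stands in front of t, the letters up to t form the same set, so the
    last factor is always \<open>a t / R\<close>.\<close>
  have ins: "weight a r (take j (d @ [t]) @ x # drop j (d @ [t])) =
      weight a r (take j d @ x # drop j d) * (a t / R)" if "j \<le> length d" for j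
  proof -
    have "set (take j d) \<union> set (drop j d) = set d" by (metis append_take_drop_id set_append)
    then have "insert t (set (take j d @ x # drop j d)) = insert x (insert t (set d))" by auto
    then show ?thesis
      using that weight_snoc[of a r "take j d @ x # drop j d" t] by (simp add: R_def)
  qed
  have "(\<Sum>j\<le>length d. (r (insert x (set (take j (d @ [t])))) - r (set (take j (d @ [t])))) *
      weight a r (take j (d @ [t]) @ x # drop j (d @ [t]))) =
    (\<Sum>j\<le>length d. (r (insert x (set (take j d))) - r (set (take j d))) *
      weight a r (take j d @ x # drop j d)) * (a t / R)"
    unfolding sum_distrib_right using ins by (intro sum.cong) auto
  also have "\<dots> = a x * weight a r d * (a t / R)" by (simp only: IH)
  finally have *: "(\<Sum>j\<le>length d. (r (insert x (set (take j (d @ [t])))) - r (set (take j (d @ [t])))) *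
      weight a r (take j (d @ [t]) @ x # drop j (d @ [t]))) = a x * weight a r d * (a t / R)" .
  have "weight a r ((d @ [t]) @ [x]) = weight a r d * (a t / q) * (a x / R)"
    by (simp add: weight_snoc R_def q_def del: append_assoc)
  then have "(\<Sum>j\<le>length (d @ [t]). (r (insert x (set (take j (d @ [t])))) - r (set (take j (d @ [t])))) *
      weight a r (take j (d @ [t]) @ x # drop j (d @ [t])))
      = a x * weight a r d * (a t / R) + (R - q) * (weight a r d * (a t / q) * (a x / R))"
    using * by (simp add: R_def q_def)
  also have "\<dots> = a x * (weight a r d * (a t / q))"
    using nz by (simp add: field_simps)
  finally show ?case by (simp add: weight_snoc q_def)
qed

text \<open>The preimage of y under extraction of the first letter satisfying P, without the words
  that lack such a letter. The set I keeps the extracted letter among those that the state space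
  admits.\<close>

definition removals :: "'a set \<Rightarrow> ('a \<Rightarrow> bool) \<Rightarrow> 'a list \<Rightarrow> 'a list set" where
  "removals I P y = {x. \<exists>c1 z c2. List.extract P x = Some (c1, z, c2) \<and> c1 @ c2 = y \<and> z \<in> I}"

lemma removals_eq_image:
  "removals I P y = (\<lambda>(z, j). take j y @ z # drop j y) `
    (SIGMA z:{z \<in> I. P z}. {j. j \<le> length y \<and> (\<forall>t\<in>set (take j y). \<not> P t)})"
proof (intro set_eqI iffI)
  fix x assume "x \<in> removals I P y"
  then obtain c1 z c2 where "x = c1 @ z # c2" "P z" "\<not> (\<exists>t\<in>set c1. P t)" "c1 @ c2 = y" "z \<in> I"
    by (auto simp: removals_def extract_Some_iff)
  then show "x \<in> (\<lambda>(z, j). take j y @ z # drop j y) `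
    (SIGMA z:{z \<in> I. P z}. {j. j \<le> length y \<and> (\<forall>t\<in>set (take j y). \<not> P t)})"
    by (intro image_eqI[where x="(z, length c1)"]) auto
next
  fix x assume "x \<in> (\<lambda>(z, j). take j y @ z # drop j y) `
    (SIGMA z:{z \<in> I. P z}. {j. j \<le> length y \<and> (\<forall>t\<in>set (take j y). \<not> P t)})"
  then obtain z j where "x = take j y @ z # drop j y" "z \<in> I" "P z" "\<forall>t\<in>set (take j y). \<not> P t"
    by auto
  then have "List.extract P x = Some (take j y, z, drop j y)" by (simp add: extract_Some_iff)
  then show "x \<in> removals I P y"
    unfolding removals_def using \<open>z \<in> I\<close> append_take_drop_id by blast
qed

lemma removalsI:
  "List.extract P x = Some (c1, z, c2) \<Longrightarrow> c1 @ c2 = y \<Longrightarrow> z \<in> I \<Longrightarrow> x \<in> removals I P y"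
  unfolding removals_def by blast

lemma removalsE:
  assumes "x \<in> removals I P y"
  obtains c1 z c2 where "List.extract P x = Some (c1, z, c2)" "c1 @ c2 = y" "z \<in> I"
    "x = c1 @ z # c2" "P z"
  using assms extract_SomeE[of P x] unfolding removals_def by blast

lemma finite_removals: "finite I \<Longrightarrow> finite (removals I P y)"
  unfolding removals_eq_image by (intro finite_imageI finite_SigmaI) auto

text \<open>The word determines the letter and its position, because extraction finds the first
  letter satisfying P. Hence the sum over preimages may run over letters and admissible
  positions.\<close>

lemma sum_removals:
  "(\<Sum>x\<in>removals I P y. f x) =
    (\<Sum>z | z \<in> I \<and> P z. \<Sum>j | j \<le> length y \<and> (\<forall>t\<in>set (take j y). \<not> P t). f (take j y @ z # drop j y))"
  if "finite I"
proof -
  have "inj_on (\<lambda>(z, j). take j y @ z # drop j y)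
    (SIGMA z:{z \<in> I. P z}. {j. j \<le> length y \<and> (\<forall>t\<in>set (take j y). \<not> P t)})"
  proof (rule inj_onI, clarify)
    fix z j z' j'
    assume eq: "take j y @ z # drop j y = take j' y @ z' # drop j' y"
      and "P z" "P z'" "\<forall>t\<in>set (take j y). \<not> P t" "\<forall>t\<in>set (take j' y). \<not> P t"
      and len: "j \<le> length y" "j' \<le> length y"
    then have "List.extract P (take j y @ z # drop j y) = Some (take j y, z, drop j y)"
      "List.extract P (take j y @ z # drop j y) = Some (take j' y, z', drop j' y)"
      by (auto simp: extract_Some_iff)
    then have "take j y = take j' y" "z = z'" by auto
    then show "z = z' \<and> j = j'" using len by (metis length_take min.absorb2)
  qed
  then have "(\<Sum>x\<in>removals I P y. f x) =
    (\<Sum>(z, j)\<in>(SIGMA z:{z \<in> I. P z}. {j. j \<le> length y \<and> (\<forall>t\<in>set (take j y). \<not> P t)}).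
      f (take j y @ z # drop j y))"
    unfolding removals_eq_image by (subst sum.reindex) (auto simp: case_prod_beta)
  also have "\<dots> = (\<Sum>z | z \<in> I \<and> P z. \<Sum>j | j \<le> length y \<and> (\<forall>t\<in>set (take j y). \<not> P t).
      f (take j y @ z # drop j y))"
    using that by (subst sum.Sigma) auto
  finally show ?thesis .
qed

text \<open>This covers two cases: words of waiting job types, from which the completions at the servers
  remove letters, and words of idle servers, from which the arrivals of the job types remove
  letters.\<close>

definition cover_rate :: "'e set \<Rightarrow> ('e \<Rightarrow> real) \<Rightarrow> ('e \<Rightarrow> 'a \<Rightarrow> bool) \<Rightarrow> 'a set \<Rightarrow> real" where
  "cover_rate E \<rho> P A = (\<Sum>e | e \<in> E \<and> (\<exists>x\<in>A. P e x). \<rho> e)"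

lemma cover_rate_empty [simp]: "cover_rate E \<rho> P {} = 0"
  by (simp add: cover_rate_def)

lemma cover_rate_pos:
  assumes "finite E" "\<And>e. e \<in> E \<Longrightarrow> 0 < \<rho> e" "x \<in> A" "e \<in> E" "P e x"
  shows "0 < cover_rate E \<rho> P A"
  unfolding cover_rate_def using assms by (intro sum_pos) auto

text \<open>Adding z to a set A raises \<open>cover_rate\<close> by the rates of the events that can
  take z but nothing in A. Behind a prefix with letters A these are exactly the events that extract
  z, so exchanging the sums produces the coefficients of \<open>weight_insertion\<close>.\<close>

lemma weight_removal_balance:
  assumes fin: "finite E" "finite I"
    and nz: "\<And>A. A \<noteq> {} \<Longrightarrow> A \<subseteq> I \<union> set y \<Longrightarrow> cover_rate E \<rho> P A \<noteq> 0"
  shows "(\<Sum>e\<in>E. \<rho> e * (\<Sum>x\<in>removals I (P e) y. weight a (cover_rate E \<rho> P) x)) =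
    (\<Sum>z\<in>I. a z) * weight a (cover_rate E \<rho> P) y"
proof -
  let ?r = "cover_rate E \<rho> P" and ?ins = "\<lambda>z j. take j y @ z # drop j y"
  have diff: "?r (insert z A) - ?r A = (\<Sum>e\<in>E. \<rho> e * of_bool (P e z \<and> (\<forall>t\<in>A. \<not> P e t)))" for z A
  proof -
    have r: "?r B = (\<Sum>e\<in>E. \<rho> e * of_bool (\<exists>x\<in>B. P e x))" for B
      using fin by (simp add: cover_rate_def of_bool_def if_distrib sum.If_cases Int_def cong: if_cong)
    show ?thesis unfolding r sum_subtractf[symmetric] right_diff_distrib[symmetric]
      by (intro sum.cong) auto
  qed
  have "(\<Sum>e\<in>E. \<rho> e * (\<Sum>x\<in>removals I (P e) y. weight a ?r x)) =
     (\<Sum>e\<in>E. \<Sum>z\<in>I. \<Sum>j\<le>length y.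
       \<rho> e * of_bool (P e z \<and> (\<forall>t\<in>set (take j y). \<not> P e t)) * weight a ?r (?ins z j))"
  proof (intro sum.cong refl)
    fix e assume "e \<in> E"
    have "(\<Sum>x\<in>removals I (P e) y. weight a ?r x) = (\<Sum>z\<in>I. \<Sum>j\<le>length y.
        of_bool (P e z \<and> (\<forall>t\<in>set (take j y). \<not> P e t)) * weight a ?r (?ins z j))"
      unfolding sum_removals[OF fin(2)] using fin(2)
      by (intro sum.mono_neutral_cong_left ballI sum.neutral) (auto intro!: sum.mono_neutral_cong_left)
    then show "\<rho> e * (\<Sum>x\<in>removals I (P e) y. weight a ?r x) = (\<Sum>z\<in>I. \<Sum>j\<le>length y.
       \<rho> e * of_bool (P e z \<and> (\<forall>t\<in>set (take j y). \<not> P e t)) * weight a ?r (?ins z j))"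
      by (simp only: sum_distrib_left mult.assoc)
  qed
  also have "\<dots> = (\<Sum>z\<in>I. \<Sum>j\<le>length y. (?r (insert z (set (take j y))) - ?r (set (take j y))) *
       weight a ?r (?ins z j))"
    unfolding diff sum_distrib_right
    by (subst sum.swap, intro sum.cong refl, subst sum.swap) (rule refl)
  also have "\<dots> = (\<Sum>z\<in>I. a z * weight a ?r y)"
    using nz by (intro sum.cong refl weight_insertion) auto
  finally show ?thesis by (simp add: sum_distrib_right)
qed

section \<open>Total weight of the words with a given set of letters\<close>

definition level :: "('a \<Rightarrow> real) \<Rightarrow> ('a set \<Rightarrow> real) \<Rightarrow> 'a set \<Rightarrow> real" where
  "level a r T = (\<Sum>\<^sub>\<infinity>c\<in>{c. set c = T}. weight a r c)"

text \<open>For the arrival rates and \<open>job_rate\<close> this is the known stability condition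
  for the sets of types inside T. It is hereditary, which the recursion through T - {x} relies
  on.\<close>

definition stable :: "('a \<Rightarrow> real) \<Rightarrow> ('a set \<Rightarrow> real) \<Rightarrow> 'a set \<Rightarrow> bool" where
  "stable a r T \<longleftrightarrow> (\<forall>x\<in>T. 0 \<le> a x) \<and> (\<forall>A\<subseteq>T. A \<noteq> {} \<longrightarrow> sum a A < r A)"

lemma stable_subset: "stable a r T \<Longrightarrow> A \<subseteq> T \<Longrightarrow> stable a r A"
  unfolding stable_def by blast

lemma stable_total:
  assumes "stable a r T" "T \<noteq> {}"
  shows "sum a T < r T" "0 < r T"
proof -
  show "sum a T < r T" using assms by (simp add: stable_def)
  moreover have "0 \<le> sum a T" using assms(1) by (simp add: stable_def sum_nonneg)
  ultimately show "0 < r T" by simp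
qed

lemma stable_weight_nonneg:
  assumes "stable a r T" "set c \<subseteq> T"
  shows "0 \<le> weight a r c"
proof -
  have "0 \<le> r (set (take (Suc i) c))" if "i < length c" for i
  proof -
    have sub: "set (take (Suc i) c) \<subseteq> T" using assms(2) set_take_subset by fastforce
    have "set (take (Suc i) c) \<noteq> {}" using that by auto
    then have "sum a (set (take (Suc i) c)) < r (set (take (Suc i) c))"
      using assms(1) sub unfolding stable_def by blast
    moreover have "0 \<le> sum a (set (take (Suc i) c))"
      using assms(1) sub unfolding stable_def by (intro sum_nonneg) auto
    ultimately show ?thesis by simp
  qed
  moreover have "0 \<le> a (c ! i)" if "i < length c" for i
    using assms that nth_mem unfolding stable_def by blast
  ultimately show ?thesis unfolding weight_def by (intro prod_nonneg) auto
qed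

lemma level_empty [simp]: "level a r {} = 1"
  by (simp add: level_def)

lemma level_nonneg: "stable a r T \<Longrightarrow> 0 \<le> level a r T"
  unfolding level_def by (intro infsum_nonneg) (auto intro: stable_weight_nonneg)

text \<open>Either the last letter x occurred before, and the prefix already uses all of T, or it
  did not, and the prefix uses T - {x}.\<close>

lemma lists_with_set_snoc:
  assumes "T \<noteq> {}"
  shows "{c. set c = T} = (\<Union>x\<in>T. (\<lambda>d. d @ [x]) ` ({d. set d = T} \<union> {d. set d = T - {x}}))"
proof (intro set_eqI iffI)
  fix c assume c: "c \<in> {c. set c = T}"
  then obtain d x where [simp]: "c = d @ [x]" using assms by (cases c rule: rev_cases) auto
  have "x \<in> T" "set d = T \<or> set d = T - {x}" using c by auto
  then show "c \<in> (\<Union>x\<in>T. (\<lambda>d. d @ [x]) ` ({d. set d = T} \<union> {d. set d = T - {x}}))" by auto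
qed (use insert_absorb in auto)

lemma weight_snoc_level:
  assumes "x \<in> T" "set d = T \<or> set d = T - {x}"
  shows "weight a r (d @ [x]) = weight a r d * (a x / r T)"
proof -
  have "insert x (set d) = T" using assms by blast
  then show ?thesis by (simp add: weight_snoc)
qed

text \<open>Truncating the length turns the recursion on the last letter into a contraction with factor
  \<open>sum a T / r T < 1\<close>, which bounds the partial sums.\<close>

lemma weight_summable:
  assumes "finite T" "stable a r T"
  shows "weight a r summable_on {c. set c = T}"
  using assms
proof (induction T rule: finite_psubset_induct)
  case (psubset T)
  show ?case
  proof (cases "T = {}")
    case False
    have st: "stable a r T" by fact
    have pos: "r T > 0" and lt: "sum a T < r T" and a0: "\<And>x. x \<in> T \<Longrightarrow> 0 \<le> a x"
      using stable_total[OF st False] st by (simp_all add: stable_def)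
    define L where "L n A = {c. set c = A \<and> length c \<le> n}" for n and A :: "'a set"
    define s where "s n A = (\<Sum>c\<in>L n A. weight a r c)" for n A
    \<comment> \<open>Total weight of the words over T whose last letter is new. It bounds the
      inhomogeneous part of the recursion for every truncation.\<close>
    define B where "B = (\<Sum>x\<in>T. a x / r T * level a r (T - {x}))"
    have finL: "finite (L n A)" if "A \<subseteq> T" for n A
      by (rule finite_subset[OF _ finite_lists_length_le[of T n]])
        (use that psubset.hyps in \<open>auto simp: L_def\<close>)
    have s_sub: "s n (T - {x}) \<le> level a r (T - {x})" if "x \<in> T" for n x
      unfolding s_def level_def
    proof (rule finite_sum_le_infsum)
      show "weight a r summable_on {c. set c = T - {x}}"
        using that st by (intro psubset.IH) (auto intro: stable_subset)
    qed (use finL st in \<open>auto simp: L_def intro: stable_weight_nonneg\<close>)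
    have L_Suc: "L (Suc n) T = (\<Union>x\<in>T. (\<lambda>d. d @ [x]) ` (L n T \<union> L n (T - {x})))" for n
    proof (intro set_eqI iffI)
      fix c assume c: "c \<in> L (Suc n) T"
      then have "c \<in> {c. set c = T}" by (simp add: L_def)
      then have "c \<in> (\<Union>x\<in>T. (\<lambda>d. d @ [x]) ` ({d. set d = T} \<union> {d. set d = T - {x}}))"
        by (simp only: lists_with_set_snoc[OF False, symmetric])
      then obtain x d where xd: "x \<in> T" "c = d @ [x]" "set d = T \<or> set d = T - {x}" by blast
      then have "d \<in> L n T \<union> L n (T - {x})" using c by (simp add: L_def)
      then show "c \<in> (\<Union>x\<in>T. (\<lambda>d. d @ [x]) ` (L n T \<union> L n (T - {x})))"
        using xd by blast
    next
      fix c assume "c \<in> (\<Union>x\<in>T. (\<lambda>d. d @ [x]) ` (L n T \<union> L n (T - {x})))"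
      then obtain x d where "x \<in> T" "c = d @ [x]" "d \<in> L n T \<union> L n (T - {x})" by blast
      then show "c \<in> L (Suc n) T" by (simp add: L_def) blast
    qed
    have s_Suc: "s (Suc n) T = sum a T / r T * s n T + (\<Sum>x\<in>T. a x / r T * s n (T - {x}))" for n
    proof -
      have "s (Suc n) T = (\<Sum>x\<in>T. \<Sum>c\<in>(\<lambda>d. d @ [x]) ` (L n T \<union> L n (T - {x})). weight a r c)"
        unfolding s_def L_Suc using psubset.hyps finL by (intro sum.UNION_disjoint) auto
      also have "\<dots> = (\<Sum>x\<in>T. a x / r T * s n T + a x / r T * s n (T - {x}))"
      proof (intro sum.cong refl)
        fix x assume x: "x \<in> T"
        have "(\<Sum>c\<in>(\<lambda>d. d @ [x]) ` (L n T \<union> L n (T - {x})). weight a r c) =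
            (\<Sum>d\<in>L n T \<union> L n (T - {x}). weight a r d * (a x / r T))"
        proof (subst sum.reindex)
          show "inj_on (\<lambda>d. d @ [x]) (L n T \<union> L n (T - {x}))" by (simp add: inj_on_def)
          show "sum (weight a r \<circ> (\<lambda>d. d @ [x])) (L n T \<union> L n (T - {x})) =
              (\<Sum>d\<in>L n T \<union> L n (T - {x}). weight a r d * (a x / r T))"
            unfolding o_def
            by (intro sum.cong refl weight_snoc_level[OF x]) (simp add: L_def, blast)
        qed
        also have "\<dots> = (\<Sum>d\<in>L n T. weight a r d * (a x / r T)) + (\<Sum>d\<in>L n (T - {x}). weight a r d * (a x / r T))"
        proof (rule sum.union_disjoint)
          have "T \<noteq> T - {x}" using x by blast
          then show "L n T \<inter> L n (T - {x}) = {}" unfolding L_def by blast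
        qed (use finL in auto)
        finally show "(\<Sum>c\<in>(\<lambda>d. d @ [x]) ` (L n T \<union> L n (T - {x})). weight a r c) =
            a x / r T * s n T + a x / r T * s n (T - {x})"
          by (simp add: s_def sum_distrib_left mult_ac)
      qed
      finally show ?thesis by (simp add: sum.distrib sum_distrib_right sum_divide_distrib)
    qed
    have ratio: "0 \<le> sum a T / r T" "sum a T / r T < 1"
      using lt pos a0 by (auto intro!: divide_nonneg_pos sum_nonneg)
    have B: "(\<Sum>x\<in>T. a x / r T * s n (T - {x})) \<le> B" for n
      unfolding B_def using s_sub a0 pos by (intro sum_mono mult_left_mono) auto
    have B0: "0 \<le> B"
      unfolding B_def using a0 pos st
      by (intro sum_nonneg mult_nonneg_nonneg level_nonneg) (auto intro: stable_subset)
    \<comment> \<open>With q = \<open>sum a T / r T\<close>, the bound is the fixed point of s -> q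
      s + B, and the truncated sums start below it at 0.\<close>
    have bound: "s n T \<le> B / (1 - sum a T / r T)" for n
    proof (induction n)
      case 0
      have "L 0 T = {}" using False by (auto simp: L_def)
      then show ?case using B0 ratio(2) by (simp add: s_def)
    next
      case (Suc n)
      define q where "q = sum a T / r T"
      have "s (Suc n) T \<le> q * s n T + B" using s_Suc[of n] B[of n] by (simp add: q_def)
      also have "\<dots> \<le> q * (B / (1 - q)) + B" 
        unfolding q_def using mult_left_mono[OF Suc.IH ratio(1)] by linarith
      also have "\<dots> = B / (1 - q)" using ratio unfolding q_def[symmetric] by (simp add: field_simps)
      finally show ?case by (simp add: q_def)
    qed
    show ?thesis
    proof (rule nonneg_bdd_above_summable_on)
      show "bdd_above (sum (weight a r) ` {F. F \<subseteq> {c. set c = T} \<and> finite F})"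
      proof (rule bdd_aboveI2)
        fix F assume F: "F \<in> {F. F \<subseteq> {c. set c = T} \<and> finite F}"
        \<comment> \<open>Each length in F is at most the sum of all lengths, which makes sense for
          empty F too.\<close>
        define n where "n = (\<Sum>c\<in>F. length c)"
        have "F \<subseteq> L n T" using F by (auto simp: L_def n_def intro: member_le_sum)
        then have "sum (weight a r) F \<le> s n T"
          unfolding s_def using st finL by (intro sum_mono2) (auto simp: L_def intro: stable_weight_nonneg)
        then show "sum (weight a r) F \<le> B / (1 - sum a T / r T)" using bound[of n] by simp
      qed
    qed (use st in \<open>auto intro: stable_weight_nonneg\<close>)
  qed simp
qed

lemma level_has_sum:
  "finite T \<Longrightarrow> stable a r T \<Longrightarrow> (weight a r has_sum level a r T) {c. set c = T}"
  unfolding level_def by (intro has_sum_infsum weight_summable)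

lemma level_rec:
  assumes "finite T" "stable a r T" "T \<noteq> {}"
  shows "(r T - sum a T) * level a r T = (\<Sum>x\<in>T. a x * level a r (T - {x}))"
proof -
  have r: "r T \<noteq> 0"
    using stable_total[OF assms(2,3)] by simp
  have "(weight a r has_sum (\<Sum>x\<in>T. (level a r T + level a r (T - {x})) * (a x / r T))) {c. set c = T}"
  proof (subst lists_with_set_snoc[OF assms(3)], intro sum_has_sum)
    fix x assume x: "x \<in> T"
    have "(weight a r has_sum level a r T + level a r (T - {x})) ({d. set d = T} \<union> {d. set d = T - {x}})"
      using x assms by (intro has_sum_Un_disjoint level_has_sum) (auto intro: stable_subset)
    then have H: "((\<lambda>d. weight a r d * (a x / r T)) has_sum
        (level a r T + level a r (T - {x})) * (a x / r T)) ({d. set d = T} \<union> {d. set d = T - {x}})"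
      by (rule has_sum_cmult_left)
    have E: "weight a r (d @ [x]) = weight a r d * (a x / r T)"
      if "d \<in> {d. set d = T} \<union> {d. set d = T - {x}}" for d
      using that by (intro weight_snoc_level[OF x]) blast
    have "((\<lambda>d. weight a r (d @ [x])) has_sum
        (level a r T + level a r (T - {x})) * (a x / r T)) ({d. set d = T} \<union> {d. set d = T - {x}})"
      by (rule has_sum_cong[THEN iffD2, OF E H])
    then show "(weight a r has_sum (level a r T + level a r (T - {x})) * (a x / r T))
        ((\<lambda>d. d @ [x]) ` ({d. set d = T} \<union> {d. set d = T - {x}}))"
      by (subst has_sum_reindex) (simp_all add: inj_on_def o_def)
  qed (use assms in auto)
  then have "level a r T = (\<Sum>x\<in>T. (level a r T + level a r (T - {x})) * (a x / r T))"
    using level_has_sum[OF assms(1,2)] has_sum_unique by blast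
  also have "\<dots> = (\<Sum>x\<in>T. (level a r T + level a r (T - {x})) * a x) / r T"
    by (simp add: sum_divide_distrib)
  finally have "r T * level a r T = (\<Sum>x\<in>T. (level a r T + level a r (T - {x})) * a x)"
    using r by (simp add: field_simps)
  then show ?thesis
    by (simp add: algebra_simps sum.distrib sum_distrib_right)
qed

lemma level_pos:
  assumes "finite T" "stable a r T" "\<And>x. x \<in> T \<Longrightarrow> 0 < a x"
  shows "0 < level a r T"
  using assms
proof (induction T rule: finite_psubset_induct)
  case (psubset T)
  show ?case
  proof (cases "T = {}")
    case False
    have "0 < (\<Sum>x\<in>T. a x * level a r (T - {x}))"
      using psubset False by (intro sum_pos mult_pos_pos psubset.IH) (auto intro: stable_subset)
    then have "0 < (r T - sum a T) * level a r T"
      using level_rec psubset False by metis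
    moreover have "sum a T < r T" using psubset.prems(1) False by (auto simp: stable_def)
    ultimately show ?thesis by (simp add: zero_less_mult_iff)
  qed simp
qed

text \<open>Solving \<open>level_rec\<close> expresses a level rationally in the rates and the
  levels of T - {x}, so continuity follows by induction on T instead of exchanging a limit with an
  infinite sum. Stability of the limit rates b keeps the limiting denominator away from 0.\<close>

lemma level_tendsto:
  assumes "finite T" "\<And>x. x \<in> T \<Longrightarrow> ((\<lambda>i. a i x) \<longlongrightarrow> b x) F"
    and "eventually (\<lambda>i. stable (a i) r T) F" "stable b r T"
  shows "((\<lambda>i. level (a i) r T) \<longlongrightarrow> level b r T) F"
  using assms
proof (induction T rule: finite_psubset_induct)
  case (psubset T)
  show ?case
  proof (cases "T = {}")
    case False
    have solve: "level c r T = (\<Sum>x\<in>T. c x * level c r (T - {x})) / (r T - sum c T)"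
      if "stable c r T" for c
    proof -
      have "r T - sum c T \<noteq> 0" using that False by (auto simp: stable_def)
      then show ?thesis using level_rec[OF psubset.hyps that False] by (simp add: field_simps)
    qed
    have "((\<lambda>i. (\<Sum>x\<in>T. a i x * level (a i) r (T - {x})) / (r T - sum (a i) T)) \<longlongrightarrow>
      (\<Sum>x\<in>T. b x * level b r (T - {x})) / (r T - sum b T)) F"
    proof (intro tendsto_divide tendsto_sum tendsto_mult tendsto_diff tendsto_const)
      fix x assume "x \<in> T"
      then show "((\<lambda>i. level (a i) r (T - {x})) \<longlongrightarrow> level b r (T - {x})) F"
        using psubset.prems by (intro psubset.IH) (auto elim!: eventually_mono intro: stable_subset)
    next
      show "r T - sum b T \<noteq> 0" using psubset.prems(3) False by (auto simp: stable_def)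
    qed (use psubset.prems in auto)
    then show ?thesis
      unfolding solve[OF psubset.prems(3)]
      by (rule Lim_transform_eventually)
        (use psubset.prems(2) in \<open>eventually_elim, metis solve\<close>)
  qed simp
qed

lemma weight_has_sum_lists:
  assumes "finite I" "stable a r I"
  shows "(weight a r has_sum (\<Sum>T\<in>Pow I. level a r T)) {c. set c \<subseteq> I}"
proof -
  have "{c. set c \<subseteq> I} = (\<Union>T\<in>Pow I. {c. set c = T})" by auto
  then show ?thesis
    using assms
    by (auto intro!: sum_has_sum level_has_sum intro: stable_subset finite_subset)
qed

section \<open>Cancel-on-completion\<close>

definition normalized_pmf :: "('s \<Rightarrow> real) \<Rightarrow> 's set \<Rightarrow> 's pmf" where
  "normalized_pmf w X = embed_pmf (\<lambda>x. if x \<in> X then w x / infsum w X else 0)"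

lemma pmf_normalized_pmf:
  assumes "(w has_sum Z) X" "0 < Z" "\<And>x. x \<in> X \<Longrightarrow> 0 \<le> w x"
  shows "pmf (normalized_pmf w X) x = (if x \<in> X then w x / Z else 0)"
proof -
  have Z: "infsum w X = Z" using assms(1) by (rule infsumI)
  have "((\<lambda>x. w x / Z) has_sum Z / Z) X"
    using has_sum_cmult_left[OF assms(1), of "1 / Z"] by simp
  then have "((\<lambda>x. if x \<in> X then w x / Z else 0) has_sum 1) UNIV"
    using assms(2) has_sum_cong_neutral[of UNIV X "\<lambda>x. if x \<in> X then w x / Z else 0" "\<lambda>x. w x / Z" 1]
    by simp
  then have "(\<integral>\<^sup>+x. ennreal (if x \<in> X then w x / Z else 0) \<partial>count_space UNIV) = ennreal 1"
    by (rule nn_integral_count_space_has_sum) (use assms in auto)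
  then show ?thesis
    unfolding normalized_pmf_def Z by (subst pmf_embed_pmf) (use assms in auto)
qed

lemma expectation_normalized_pmf:
  assumes w: "(w has_sum Z) X" "0 < Z" "\<And>x. x \<in> X \<Longrightarrow> 0 \<le> w x"
    and g: "((\<lambda>x. w x * g x) has_sum s) X" "\<And>x. x \<in> X \<Longrightarrow> 0 \<le> g x"
  shows "measure_pmf.expectation (normalized_pmf w X) g = s / Z"
proof -
  let ?f = "\<lambda>x. pmf (normalized_pmf w X) x * g x"
  have "((\<lambda>x. w x * g x * (1 / Z)) has_sum s * (1 / Z)) X"
    using g(1) by (rule has_sum_cmult_left)
  then have "(?f has_sum s * (1 / Z)) UNIV"
    by (rule has_sum_cong_neutral[THEN iffD1, rotated -1]) (auto simp: pmf_normalized_pmf[OF w])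
  then have f: "(?f has_sum s / Z) UNIV" by simp
  have nonneg: "0 \<le> ?f x" for x
    using g(2) by (cases "x \<in> X") (auto simp: pmf_normalized_pmf[OF w] w intro!: mult_nonneg_nonneg divide_nonneg_pos)
  have "(\<lambda>x. norm (?f x)) summable_on UNIV"
    using has_sum_imp_summable[OF f] nonneg by simp
  then have abs: "Infinite_Set_Sum.abs_summable_on ?f UNIV"
    using abs_summable_equivalent by blast
  have "measure_pmf.expectation (normalized_pmf w X) g = infsetsum ?f UNIV"
    by (simp add: pmf_expectation_eq_infsetsum)
  also have "\<dots> = s / Z"
    using infsetsum_infsum[OF abs] infsumI[OF f] by simp
  finally show ?thesis .
qed

lemma set_normalized_pmf:
  assumes "(w has_sum Z) X" "0 < Z" "\<And>x. x \<in> X \<Longrightarrow> 0 \<le> w x"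
  shows "set_pmf (normalized_pmf w X) \<subseteq> X"
  by (auto simp: set_pmf_iff pmf_normalized_pmf[OF assms] split: if_splits)

text \<open>Finite preimages turn the inflow into a finite sum of unnormalized weights. Outside X
  both sides of the invariance equation vanish because X is closed under the events.\<close>

lemma (in queue_rates) invariant_normalized_pmf:
  fixes w :: "'s \<Rightarrow> real"
  assumes w: "(w has_sum Z) X" "0 < Z" "\<And>x. x \<in> X \<Longrightarrow> 0 \<le> w x"
    and closed: "\<And>S x. S \<in> \<S> \<Longrightarrow> x \<in> X \<Longrightarrow> arr S x \<in> X" "\<And>n x. x \<in> X \<Longrightarrow> dep n x \<in> X"
    and fin: "\<And>S y. S \<in> \<S> \<Longrightarrow> y \<in> X \<Longrightarrow> finite {x \<in> X. arr S x = y}"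
      "\<And>n y. y \<in> X \<Longrightarrow> finite {x \<in> X. dep n x = y}"
    and balance: "\<And>y. y \<in> X \<Longrightarrow> total_rate \<mu> \<S> p lam * w y =
      (\<Sum>S\<in>\<S>. arr_rate S * (\<Sum>x | x \<in> X \<and> arr S x = y. w x)) +
      (\<Sum>n\<in>UNIV. \<mu> n * (\<Sum>x | x \<in> X \<and> dep n x = y. w x))"
  shows "invariant_pmf (event_pmf \<mu> \<S> p lam) (case_sum arr dep) (normalized_pmf w X)"
  unfolding invariant_event_pmf_iff
proof
  fix y :: 's
  let ?\<nu> = "normalized_pmf w X"
  have pmf: "pmf ?\<nu> x = (if x \<in> X then w x / Z else 0)" for x
    by (rule pmf_normalized_pmf[OF w])
  have supp: "set_pmf ?\<nu> \<subseteq> X" by (rule set_normalized_pmf[OF w])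
  have prob: "measure_pmf.prob ?\<nu> (h -` {y}) = (\<Sum>x | x \<in> X \<and> h x = y. w x) / Z"
    if "finite {x \<in> X. h x = y}" for h
  proof -
    have "measure_pmf.prob ?\<nu> (h -` {y}) = measure_pmf.prob ?\<nu> {x \<in> X. h x = y}"
      by (rule measure_prob_cong_0) (use supp in \<open>auto simp: set_pmf_iff\<close>)
    also have "\<dots> = (\<Sum>x | x \<in> X \<and> h x = y. w x / Z)"
      using that by (simp add: measure_measure_pmf_finite pmf)
    finally show ?thesis by (simp add: sum_divide_distrib)
  qed
  show "total_rate \<mu> \<S> p lam * pmf ?\<nu> y =
      (\<Sum>S\<in>\<S>. arr_rate S * measure_pmf.prob ?\<nu> (arr S -` {y})) +
      (\<Sum>n\<in>UNIV. \<mu> n * measure_pmf.prob ?\<nu> (dep n -` {y}))"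
  proof (cases "y \<in> X")
    case True
    then have "total_rate \<mu> \<S> p lam * pmf ?\<nu> y = (total_rate \<mu> \<S> p lam * w y) / Z"
      by (simp add: pmf)
    also have "\<dots> = (\<Sum>S\<in>\<S>. arr_rate S * ((\<Sum>x | x \<in> X \<and> arr S x = y. w x) / Z)) +
      (\<Sum>n\<in>UNIV. \<mu> n * ((\<Sum>x | x \<in> X \<and> dep n x = y. w x) / Z))"
      unfolding balance[OF True]
      by (simp only: times_divide_eq_right sum_divide_distrib[symmetric] add_divide_distrib)
    also have "\<dots> = (\<Sum>S\<in>\<S>. arr_rate S * measure_pmf.prob ?\<nu> (arr S -` {y})) +
      (\<Sum>n\<in>UNIV. \<mu> n * measure_pmf.prob ?\<nu> (dep n -` {y}))"
      using True fin by (simp add: prob)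
    finally show ?thesis .
  next
    case False
    then have "measure_pmf.prob ?\<nu> (arr S -` {y}) = 0" if "S \<in> \<S>" for S
      using that closed supp by (auto simp: measure_pmf_zero_iff)
    moreover have "measure_pmf.prob ?\<nu> (dep n -` {y}) = 0" for n
      using False closed supp by (auto simp: measure_pmf_zero_iff)
    ultimately show ?thesis using False by (simp add: pmf)
  qed
qed

text \<open>Arguments of the generating function between 0 and 1 only thin the arrivals.\<close>

lemma stable_mult:
  assumes "stable a r T" "\<And>x. x \<in> T \<Longrightarrow> 0 \<le> z x \<and> z x \<le> 1"
  shows "stable (\<lambda>x. a x * z x) r T"
  unfolding stable_def
proof (intro conjI ballI allI impI)
  show "0 \<le> a x * z x" if "x \<in> T" for x using assms that by (auto simp: stable_def)
  fix A assume A: "A \<subseteq> T" "A \<noteq> {}"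
  have "(\<Sum>x\<in>A. a x * z x) \<le> sum a A"
    using assms A(1) by (intro sum_mono mult_left_le) (auto simp: stable_def)
  also have "\<dots> < r A" using assms(1) A by (simp add: stable_def)
  finally show "(\<Sum>x\<in>A. a x * z x) < r A" .
qed

abbreviation job_rate :: "('n::finite \<Rightarrow> real) \<Rightarrow> 'n set set \<Rightarrow> real" where
  "job_rate \<mu> \<equiv> cover_rate UNIV \<mu> (\<in>)"

lemma job_rate_eq: "job_rate \<mu> A = (\<Sum>n\<in>\<Union>A. \<mu> n)"
  unfolding cover_rate_def by (intro sum.cong) auto

lemma stable_rate_nonzero:
  assumes "stable a r T" "A \<noteq> {}" "A \<subseteq> T"
  shows "r A \<noteq> 0"
  using stable_total(2)[OF stable_subset[OF assms(1,3)] assms(2)] by simp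

section \<open>The cancel-on-completion chain and its generating function\<close>

locale stable_queue = queue_rates \<mu> \<S> p lam
  for \<mu> :: "'n::finite \<Rightarrow> real" and \<S> :: "'n set set" and p :: "'n set \<Rightarrow> real" and lam :: real +
  assumes stable: "stable (\<lambda>S. real CARD('n) * lam * p S) (job_rate \<mu>) \<S>"
    and nonempty_types: "{} \<notin> \<S>" and covering: "\<Union>\<S> = UNIV"
begin

text \<open>These are the servers without a compatible job. Their potential completions leave the
  state unchanged and supply the self-loops of the c.o.c. balance.\<close>

lemma sum_rate_split:
  "(\<Sum>n\<in>UNIV. \<mu> n * of_bool (\<forall>T\<in>A. n \<notin> T)) = (\<Sum>n\<in>UNIV. \<mu> n) - job_rate \<mu> A"
proof -
  have "(\<Sum>n\<in>UNIV. \<mu> n) = (\<Sum>n\<in>\<Union>A. \<mu> n) + (\<Sum>n\<in>- \<Union>A. \<mu> n)"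
    by (subst sum.union_disjoint[symmetric]) (auto intro!: sum.cong)
  moreover have "(\<Sum>n\<in>UNIV. \<mu> n * of_bool (\<forall>T\<in>A. n \<notin> T)) = (\<Sum>n\<in>- \<Union>A. \<mu> n)"
    by (intro sum.mono_neutral_cong_right) auto
  ultimately show ?thesis by (simp add: job_rate_eq)
qed

abbreviation "coc_weight \<equiv> weight arr_rate (job_rate \<mu>)"

lemma coc_arrival_preimage:
  "set y \<subseteq> \<S> \<Longrightarrow> {x \<in> coc_states \<S>. coc_arrival S x = y} = {d. y = d @ [S]}"
  by (auto simp: coc_arrival_def coc_states_def)

lemma finite_snoc_preimage: "finite {d. y = d @ [S]}"
  by (rule finite_subset[of _ "{butlast y}"]) auto

lemma coc_completion_preimage:
  assumes "set y \<subseteq> \<S>"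
  shows "{x \<in> coc_states \<S>. coc_completion n x = y} =
    (if \<forall>T\<in>set y. n \<notin> T then {y} else {}) \<union> removals \<S> ((\<in>) n) y"
proof (intro set_eqI iffI)
  fix x assume x: "x \<in> {x \<in> coc_states \<S>. coc_completion n x = y}"
  show "x \<in> (if \<forall>T\<in>set y. n \<notin> T then {y} else {}) \<union> removals \<S> ((\<in>) n) y"
  proof (cases "List.extract ((\<in>) n) x")
    case None
    then have "coc_completion n x = x" by (simp add: coc_completion_def)
    moreover have "\<forall>T\<in>set x. n \<notin> T" using None by (simp add: extract_None_iff)
    ultimately show ?thesis using x by simp
  next
    case (Some t)
    then obtain c1 S c2 where ex: "List.extract ((\<in>) n) x = Some (c1, S, c2)" by (cases t) simp
    then have "x = c1 @ S # c2" by (simp add: extract_Some_iff)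
    then have "S \<in> \<S>" using x by (simp add: coc_states_def)
    moreover have "y = c1 @ c2" using x ex by (simp add: coc_completion_def)
    ultimately have "x \<in> removals \<S> ((\<in>) n) y" using ex by (auto simp: removals_def)
    then show ?thesis by simp
  qed
next
  fix x assume "x \<in> (if \<forall>T\<in>set y. n \<notin> T then {y} else {}) \<union> removals \<S> ((\<in>) n) y"
  then consider "x = y" "\<forall>T\<in>set y. n \<notin> T"
    | c1 S c2 where "List.extract ((\<in>) n) x = Some (c1, S, c2)" "c1 @ c2 = y" "S \<in> \<S>"
    by (auto simp: removals_def split: if_splits)
  then show "x \<in> {x \<in> coc_states \<S>. coc_completion n x = y}"
  proof cases
    case 1
    then have "List.extract ((\<in>) n) x = None" by (simp add: extract_None_iff)
    with 1 assms show ?thesis by (simp add: coc_completion_def coc_states_def)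
  next
    case 2
    then have "x = c1 @ S # c2" by (simp add: extract_Some_iff)
    with 2 assms show ?thesis by (auto simp: coc_completion_def coc_states_def)
  qed
qed

lemma coc_closed:
  "S \<in> \<S> \<Longrightarrow> x \<in> coc_states \<S> \<Longrightarrow> coc_arrival S x \<in> coc_states \<S>"
  "x \<in> coc_states \<S> \<Longrightarrow> coc_completion n x \<in> coc_states \<S>"
proof -
  show "coc_completion n x \<in> coc_states \<S>" if x: "x \<in> coc_states \<S>"
  proof (cases "List.extract ((\<in>) n) x")
    case None
    then show ?thesis using x by (simp add: coc_completion_def)
  next
    case (Some t)
    then obtain c1 S c2 where ex: "List.extract ((\<in>) n) x = Some (c1, S, c2)" by (cases t) simp
    then have "x = c1 @ S # c2" by (simp add: extract_Some_iff)
    with x ex show ?thesis by (simp add: coc_completion_def coc_states_def)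
  qed
qed (simp add: coc_states_def coc_arrival_def)

lemma level_sum_pos:
  assumes "I \<subseteq> \<S>"
  shows "0 < (\<Sum>T\<in>Pow I. level arr_rate (job_rate \<mu>) T)"
proof (intro sum_pos level_pos)
  show "stable arr_rate (job_rate \<mu>) T" if "T \<in> Pow I" for T
    using that assms by (intro stable_subset[OF stable]) auto
  show "0 < arr_rate S" if "T \<in> Pow I" "S \<in> T" for S T
    using that assms by (intro arrival_rate_pos) auto
qed auto

lemma notin_removals: "y \<notin> removals I P y"
proof
  assume "y \<in> removals I P y"
  then obtain c1 z c2 where "y = c1 @ z # c2" "c1 @ c2 = y"
    unfolding removals_def mem_Collect_eq extract_Some_iff by blast
  then have "length (c1 @ c2) = length (c1 @ z # c2)" by simp
  then show False by simp
qed

lemma sum_removals_union: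
  fixes w :: "'b list \<Rightarrow> real"
  assumes "finite I"
  shows "sum w ((if b then {y} else {}) \<union> removals I P y) = of_bool b * w y + sum w (removals I P y)"
  using assms by (auto simp: finite_removals notin_removals)

text \<open>The inflow into y has three parts, each a multiple of its weight: arrivals give
  \<open>job_rate \<mu> (set y)\<close>, completions without effect give the remaining speed, and
  true departures give the total arrival rate. The factors add up to the total rate.\<close>

lemma coc_invariant:
  "invariant_pmf (event_pmf \<mu> \<S> p lam) (case_sum coc_arrival coc_completion)
    (normalized_pmf coc_weight (coc_states \<S>))"
proof (rule invariant_normalized_pmf)
  show "(coc_weight has_sum (\<Sum>T\<in>Pow \<S>. level arr_rate (job_rate \<mu>) T)) (coc_states \<S>)"
    unfolding coc_states_def by (intro weight_has_sum_lists stable) simp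
  show "0 < (\<Sum>T\<in>Pow \<S>. level arr_rate (job_rate \<mu>) T)" by (rule level_sum_pos[OF order.refl])
  show "0 \<le> coc_weight x" if "x \<in> coc_states \<S>" for x
    using that by (intro stable_weight_nonneg[OF stable]) (simp add: coc_states_def)
  show "finite {x \<in> coc_states \<S>. coc_arrival S x = y}" if "y \<in> coc_states \<S>" for S y
    using that by (subst coc_arrival_preimage) (simp_all add: coc_states_def finite_snoc_preimage)
  show "finite {x \<in> coc_states \<S>. coc_completion n x = y}" if "y \<in> coc_states \<S>" for n y
    using that by (subst coc_completion_preimage) (auto simp: coc_states_def finite_removals)
  fix y assume y: "y \<in> coc_states \<S>"
  then have yS: "set y \<subseteq> \<S>" by (simp add: coc_states_def)
  have arr: "(\<Sum>S\<in>\<S>. arr_rate S * (\<Sum>x | x \<in> coc_states \<S> \<and> coc_arrival S x = y. coc_weight x)) =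
      job_rate \<mu> (set y) * coc_weight y"
    unfolding coc_arrival_preimage[OF yS]
    by (intro weight_snoc_balance stable_rate_nonzero[OF stable] yS) simp_all
  have "(\<Sum>n\<in>UNIV. \<mu> n * (\<Sum>x | x \<in> coc_states \<S> \<and> coc_completion n x = y. coc_weight x)) =
      (\<Sum>n\<in>UNIV. \<mu> n * of_bool (\<forall>T\<in>set y. n \<notin> T)) * coc_weight y +
      (\<Sum>n\<in>UNIV. \<mu> n * (\<Sum>x\<in>removals \<S> ((\<in>) n) y. coc_weight x))"
    unfolding coc_completion_preimage[OF yS]
    by (simp only: sum_removals_union[OF finite] distrib_left sum.distrib sum_distrib_right mult.assoc)
  also have "(\<Sum>n\<in>UNIV. \<mu> n * (\<Sum>x\<in>removals \<S> ((\<in>) n) y. coc_weight x)) = (\<Sum>S\<in>\<S>. arr_rate S) * coc_weight y"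
    using yS by (intro weight_removal_balance stable_rate_nonzero[OF stable]) auto
  finally show "total_rate \<mu> \<S> p lam * coc_weight y =
      (\<Sum>S\<in>\<S>. arr_rate S * (\<Sum>x | x \<in> coc_states \<S> \<and> coc_arrival S x = y. coc_weight x)) +
      (\<Sum>n\<in>UNIV. \<mu> n * (\<Sum>x | x \<in> coc_states \<S> \<and> coc_completion n x = y. coc_weight x))"
    unfolding arr sum_rate_split by (simp add: total_rate_def algebra_simps)
qed (simp_all add: coc_closed)

text \<open>The oldest job is first in line at every server of its type, so a potential completion
  at any of them removes it.\<close>

lemma coc_reaches_empty:
  "set c \<subseteq> \<S> \<Longrightarrow>
    reaches (set_pmf (event_pmf \<mu> \<S> p lam)) (case_sum coc_arrival coc_completion) [] c"
proof (induction c)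
  case (Cons S c)
  then obtain n where "n \<in> S" using nonempty_types by fastforce
  then have "coc_completion n (S # c) = c"
    by (simp add: coc_completion_def extract_Cons_code)
  with Cons show ?case
    by - (rule reaches.further[of "Inr n"], simp_all add: set_event_pmf)
qed (rule reaches.here)

lemma coc_stationary_product_form:
  assumes "coc_stationary \<mu> \<S> p lam \<pi>"
  shows "\<pi> = normalized_pmf coc_weight (coc_states \<S>)"
proof (rule invariant_pmf_unique)
  show "invariant_pmf (event_pmf \<mu> \<S> p lam) (case_sum coc_arrival coc_completion) \<pi>"
    using assms coc_closed unfolding coc_stationary_def by (rule stationary_imp_invariant)
  show "finite (set_pmf (event_pmf \<mu> \<S> p lam))" by simp
  have "set_pmf \<pi> \<subseteq> coc_states \<S>" using assms by (simp add: coc_stationary_def stationary_def)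
  moreover have "set_pmf (normalized_pmf coc_weight (coc_states \<S>)) \<subseteq> coc_states \<S>"
    by (rule set_normalized_pmf[OF _ level_sum_pos[OF order.refl]])
      (simp_all add: coc_states_def weight_has_sum_lists stable stable_weight_nonneg[OF stable])
  ultimately show "reaches (set_pmf (event_pmf \<mu> \<S> p lam)) (case_sum coc_arrival coc_completion) [] x"
    if "x \<in> set_pmf \<pi> \<union> set_pmf (normalized_pmf coc_weight (coc_states \<S>))" for x
    using that by (intro coc_reaches_empty) (auto simp: coc_states_def)
qed (rule coc_invariant)

lemma coc_transform:
  assumes "coc_stationary \<mu> \<S> p lam \<pi>" and z: "\<And>S. 0 \<le> z S \<and> z S \<le> 1"
  shows "measure_pmf.expectation \<pi> (\<lambda>c. prod_list (map z c)) =
    (\<Sum>T\<in>Pow \<S>. level (\<lambda>S. arr_rate S * z S) (job_rate \<mu>) T) / (\<Sum>T\<in>Pow \<S>. level arr_rate (job_rate \<mu>) T)"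
  unfolding coc_stationary_product_form[OF assms(1)]
proof (rule expectation_normalized_pmf)
  show "(coc_weight has_sum (\<Sum>T\<in>Pow \<S>. level arr_rate (job_rate \<mu>) T)) (coc_states \<S>)"
    unfolding coc_states_def by (intro weight_has_sum_lists stable) simp
  show "((\<lambda>x. coc_weight x * prod_list (map z x)) has_sum
      (\<Sum>T\<in>Pow \<S>. level (\<lambda>S. arr_rate S * z S) (job_rate \<mu>) T)) (coc_states \<S>)"
    unfolding coc_states_def weight_mult[symmetric]
    by (intro weight_has_sum_lists stable_mult[OF stable] z) simp
  show "0 \<le> prod_list (map z x)" for x using z by (intro prod_list_nonneg) auto
  show "0 \<le> coc_weight x" if "x \<in> coc_states \<S>" for x
    using that by (intro stable_weight_nonneg[OF stable]) (simp add: coc_states_def)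
qed (rule level_sum_pos[OF order.refl])

end

section \<open>Cancel-on-start\<close>

text \<open>The c.o.s. updates of the waiting and idle words never consult the served types, so
  these two words form a chain of their own, the one described by the known product form.\<close>

fun pair_arrival :: "'n set \<Rightarrow> 'n set list \<times> 'n list \<Rightarrow> 'n set list \<times> 'n list" where
  "pair_arrival S (c, u) =
     (case List.extract (\<lambda>n. n \<in> S) u of None \<Rightarrow> (c @ [S], u) | Some (u1, n, u2) \<Rightarrow> (c, u1 @ u2))"

fun pair_completion :: "'n \<Rightarrow> 'n set list \<times> 'n list \<Rightarrow> 'n set list \<times> 'n list" where
  "pair_completion n (c, u) =
     (if n \<in> set u then (c, u)
      else case List.extract (\<lambda>S. n \<in> S) c of None \<Rightarrow> (c, u @ [n]) | Some (c1, S, c2) \<Rightarrow> (c1 @ c2, u))"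

definition pair_states :: "'n set set \<Rightarrow> ('n set list \<times> 'n list) set" where
  "pair_states \<S> = {(c, u). set c \<subseteq> \<S> \<and> distinct u \<and> (\<forall>S\<in>set c. S \<inter> set u = {})}"

definition drop_served :: "'n cos_state \<Rightarrow> 'n set list \<times> 'n list" where
  "drop_served = (\<lambda>(c, u, s). (c, u))"

lemma drop_served_arrival: "drop_served (cos_arrival S x) = pair_arrival S (drop_served x)"
  by (cases x) (simp add: drop_served_def split: option.split)

lemma drop_served_completion: "drop_served (cos_completion n x) = pair_completion n (drop_served x)"
  by (cases x) (simp add: drop_served_def split: option.split)

lemma drop_served_states: "x \<in> cos_states \<S> \<Longrightarrow> drop_served x \<in> pair_states \<S>"
  by (auto simp: cos_states_def drop_served_def pair_states_def)

lemma cos_arrival_closed: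
  assumes "S \<in> \<S>" "x \<in> cos_states \<S>"
  shows "cos_arrival S x \<in> cos_states \<S>"
proof -
  obtain c u s where x: "x = (c, u, s)" by (cases x)
  show ?thesis
  proof (cases "List.extract (\<lambda>n. n \<in> S) u")
    case None
    then have "cos_arrival S x = (c @ [S], u, s)" by (simp add: x)
    moreover have "S \<inter> set u = {}" using None by (auto simp: extract_None_iff)
    ultimately show ?thesis using assms by (simp add: x cos_states_def)
  next
    case (Some t)
    then obtain u1 n u2 where ex: "List.extract (\<lambda>n. n \<in> S) u = Some (u1, n, u2)" by (cases t) simp
    then have "cos_arrival S x = (c, u1 @ u2, s(n \<mapsto> S))" by (simp add: x)
    moreover have "u = u1 @ n # u2" "n \<in> S" using extract_SomeE[OF ex] by auto
    ultimately show ?thesis using assms by (auto simp: x cos_states_def)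
  qed
qed

lemma cos_completion_closed:
  assumes "x \<in> cos_states \<S>"
  shows "cos_completion n x \<in> cos_states \<S>"
proof -
  obtain c u s where x: "x = (c, u, s)" by (cases x)
  show ?thesis
  proof (cases "n \<in> set u")
    case True
    then show ?thesis using assms by (simp add: x)
  next
    case idle: False
    show ?thesis
    proof (cases "List.extract (\<lambda>S. n \<in> S) c")
      case None
      then have "cos_completion n x = (c, u @ [n], s(n := None))" using idle by (simp add: x)
      moreover have "\<forall>S\<in>set c. n \<notin> S" using None by (simp add: extract_None_iff)
      ultimately show ?thesis using assms idle by (auto simp: x cos_states_def)
    next
      case (Some t)
      then obtain c1 S c2 where ex: "List.extract (\<lambda>S. n \<in> S) c = Some (c1, S, c2)" by (cases t) simp
      then have "cos_completion n x = (c1 @ c2, u, s(n \<mapsto> S))" using idle by (simp add: x)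
      moreover have "c = c1 @ S # c2" "n \<in> S" using extract_SomeE[OF ex] by auto
      ultimately show ?thesis using assms idle by (auto simp: x cos_states_def)
    qed
  qed
qed

text \<open>If the job joined the queue, validity of (c, u) already says that its type avoids the
  idle servers. Otherwise it took the longest idle compatible server n; for the earlier state to be
  valid, n must be new to u and incompatible with every waiting type.\<close>

lemma pair_arrival_preimage:
  assumes y: "(c, u) \<in> pair_states \<S>"
  shows "{x \<in> pair_states \<S>. pair_arrival S x = (c, u)} =
    (\<lambda>d. (d, u)) ` {d. c = d @ [S]} \<union>
    Pair c ` removals {n. n \<notin> set u \<and> (\<forall>T\<in>set c. n \<notin> T)} (\<lambda>n. n \<in> S) u"
proof (intro set_eqI iffI)
  fix x assume "x \<in> {x \<in> pair_states \<S>. pair_arrival S x = (c, u)}"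
  moreover obtain c' u' where x: "x = (c', u')" by (cases x)
  ultimately have st: "(c', u') \<in> pair_states \<S>" and eq: "pair_arrival S (c', u') = (c, u)" by auto
  show "x \<in> (\<lambda>d. (d, u)) ` {d. c = d @ [S]} \<union>
    Pair c ` removals {n. n \<notin> set u \<and> (\<forall>T\<in>set c. n \<notin> T)} (\<lambda>n. n \<in> S) u"
  proof (cases "List.extract (\<lambda>n. n \<in> S) u'")
    case None
    then show ?thesis using eq x by auto
  next
    case (Some t)
    then obtain u1 n u2 where ex: "List.extract (\<lambda>n. n \<in> S) u' = Some (u1, n, u2)" by (cases t) simp
    then have c: "c' = c" and u: "u1 @ u2 = u" using eq by auto
    have "u' = u1 @ n # u2" using extract_SomeE[OF ex] by simp
    then have "n \<in> {n. n \<notin> set u \<and> (\<forall>T\<in>set c. n \<notin> T)}"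
      using st unfolding u[symmetric] c by (auto simp: pair_states_def)
    then have "u' \<in> removals {n. n \<notin> set u \<and> (\<forall>T\<in>set c. n \<notin> T)} (\<lambda>n. n \<in> S) u"
      by (rule removalsI[OF ex u])
    then show ?thesis by (simp add: x c)
  qed
next
  fix x assume "x \<in> (\<lambda>d. (d, u)) ` {d. c = d @ [S]} \<union>
    Pair c ` removals {n. n \<notin> set u \<and> (\<forall>T\<in>set c. n \<notin> T)} (\<lambda>n. n \<in> S) u"
  then consider d where "x = (d, u)" "c = d @ [S]"
    | u' where "x = (c, u')" "u' \<in> removals {n. n \<notin> set u \<and> (\<forall>T\<in>set c. n \<notin> T)} (\<lambda>n. n \<in> S) u"
    by blast
  then show "x \<in> {x \<in> pair_states \<S>. pair_arrival S x = (c, u)}"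
  proof cases
    case 1
    then have "List.extract (\<lambda>n. n \<in> S) u = None"
      using y by (auto simp: extract_None_iff pair_states_def)
    then show ?thesis using 1 y by (simp add: pair_states_def)
  next
    case 2
    from 2(2) obtain u1 n u2 where ex: "List.extract (\<lambda>n. n \<in> S) u' = Some (u1, n, u2)"
      and u: "u1 @ u2 = u" and n: "n \<notin> set u" "\<forall>T\<in>set c. n \<notin> T" and u': "u' = u1 @ n # u2"
      by (rule removalsE) blast
    have "(c, u1 @ n # u2) \<in> pair_states \<S>"
      using y n unfolding u[symmetric] by (auto simp: pair_states_def)
    then show ?thesis using 2(1) ex u u' by simp
  qed
qed

text \<open>A completion at an idle server does nothing; a server without a compatible waiting job
  joins the end of the idle word; any other server starts its longest waiting compatible job. A job
  put back into the queue must have a type avoiding all idle servers.\<close>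

lemma pair_completion_preimage:
  assumes y: "(c, u) \<in> pair_states \<S>"
  shows "{x \<in> pair_states \<S>. pair_completion n x = (c, u)} =
    (if n \<in> set u then {(c, u)} else {}) \<union> Pair c ` {v. u = v @ [n]} \<union>
    (\<lambda>d. (d, u)) ` removals {S \<in> \<S>. S \<inter> set u = {}} (\<lambda>S. n \<in> S) c" (is "_ = ?R")
proof (intro set_eqI iffI)
  fix x assume "x \<in> {x \<in> pair_states \<S>. pair_completion n x = (c, u)}"
  moreover obtain c' u' where x: "x = (c', u')" by (cases x)
  ultimately have st: "(c', u') \<in> pair_states \<S>" and eq: "pair_completion n (c', u') = (c, u)" by auto
  show "x \<in> ?R"
  proof (cases "n \<in> set u'")
    case True
    then show ?thesis using eq x by simp
  next
    case idle: False
    show ?thesis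
    proof (cases "List.extract (\<lambda>S. n \<in> S) c'")
      case None
      then show ?thesis using eq x idle by auto
    next
      case (Some t)
      then obtain c1 S c2 where ex: "List.extract (\<lambda>S. n \<in> S) c' = Some (c1, S, c2)" by (cases t) simp
      then have u: "u' = u" and c: "c1 @ c2 = c" using eq idle by auto
      have "c' = c1 @ S # c2" using extract_SomeE[OF ex] by simp
      then have "S \<in> {S \<in> \<S>. S \<inter> set u = {}}" using st unfolding u by (auto simp: pair_states_def)
      then have "c' \<in> removals {S \<in> \<S>. S \<inter> set u = {}} (\<lambda>S. n \<in> S) c"
        by (rule removalsI[OF ex c])
      then show ?thesis by (simp add: x u)
    qed
  qed
next
  fix x assume "x \<in> ?R"
  then consider "x = (c, u)" "n \<in> set u" | v where "x = (c, v)" "u = v @ [n]"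
    | d where "x = (d, u)" "d \<in> removals {S \<in> \<S>. S \<inter> set u = {}} (\<lambda>S. n \<in> S) c"
    by (auto split: if_splits)
  then show "x \<in> {x \<in> pair_states \<S>. pair_completion n x = (c, u)}"
  proof cases
    case 1
    then show ?thesis using y by simp
  next
    case 2
    then have "List.extract (\<lambda>S. n \<in> S) c = None" "n \<notin> set v" "(c, v) \<in> pair_states \<S>"
      using y by (auto simp: extract_None_iff pair_states_def)
    then show ?thesis using 2 by simp
  next
    case 3
    from 3(2) obtain c1 S c2 where ex: "List.extract (\<lambda>S. n \<in> S) d = Some (c1, S, c2)"
      and c: "c1 @ c2 = c" and S: "S \<in> \<S>" "S \<inter> set u = {}" and d: "d = c1 @ S # c2" and n: "n \<in> S"
      by (rule removalsE) blast
    have "n \<notin> set u" using S n by blast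
    moreover have "(c1 @ S # c2, u) \<in> pair_states \<S>"
      using y S unfolding c[symmetric] by (simp add: pair_states_def)
    ultimately show ?thesis using 3(1) ex c d by simp
  qed
qed

lemma pair_arrival_closed:
  assumes "S \<in> \<S>" "x \<in> pair_states \<S>"
  shows "pair_arrival S x \<in> pair_states \<S>"
proof -
  obtain c u where x: "x = (c, u)" by (cases x)
  show ?thesis
  proof (cases "List.extract (\<lambda>n. n \<in> S) u")
    case None
    moreover have "S \<inter> set u = {}" using None by (auto simp: extract_None_iff)
    ultimately show ?thesis using assms by (simp add: x pair_states_def)
  next
    case (Some t)
    then obtain u1 n u2 where ex: "List.extract (\<lambda>n. n \<in> S) u = Some (u1, n, u2)" by (cases t) simp
    then have "u = u1 @ n # u2" using extract_SomeE[OF ex] by auto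
    with ex show ?thesis using assms by (auto simp: x pair_states_def)
  qed
qed

lemma pair_completion_closed:
  assumes "x \<in> pair_states \<S>"
  shows "pair_completion n x \<in> pair_states \<S>"
proof -
  obtain c u where x: "x = (c, u)" by (cases x)
  show ?thesis
  proof (cases "n \<in> set u")
    case True
    then show ?thesis using assms by (simp add: x)
  next
    case idle: False
    show ?thesis
    proof (cases "List.extract (\<lambda>S. n \<in> S) c")
      case None
      moreover have "\<forall>S\<in>set c. n \<notin> S" using None by (simp add: extract_None_iff)
      ultimately show ?thesis using assms idle by (auto simp: x pair_states_def)
    next
      case (Some t)
      then obtain c1 S c2 where ex: "List.extract (\<lambda>S. n \<in> S) c = Some (c1, S, c2)" by (cases t) simp
      then have "c = c1 @ S # c2" using extract_SomeE[OF ex] by auto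
      with ex show ?thesis using assms idle by (auto simp: x pair_states_def)
    qed
  qed
qed

text \<open>The denominator \<lambda>_C of the idle factors in the c.o.s. product form, as a
  function of the set of servers.\<close>

abbreviation server_rate :: "('n::finite set \<Rightarrow> real) \<Rightarrow> 'n set set \<Rightarrow> 'n set \<Rightarrow> real" where
  "server_rate a \<S> \<equiv> cover_rate \<S> a (\<lambda>S n. n \<in> S)"

lemma finite_distinct: "finite {u :: 'a::finite list. distinct u}"
proof (rule finite_subset)
  show "{u :: 'a list. distinct u} \<subseteq> {u. set u \<subseteq> UNIV \<and> length u \<le> CARD('a)}"
    by (auto simp: distinct_card[symmetric] card_mono)
qed (rule finite_lists_length_le, simp)

section \<open>Product form of the projected cancel-on-start chain\<close>

context stable_queue
begin

abbreviation "idle_weight \<equiv> weight \<mu> (server_rate arr_rate \<S>)"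
abbreviation "pair_weight \<equiv> \<lambda>x. coc_weight (fst x) * idle_weight (snd x)"
abbreviation "pair_sum a' \<equiv> (\<Sum>u | distinct u. idle_weight u *
    (\<Sum>T\<in>Pow {S \<in> \<S>. S \<inter> set u = {}}. level a' (job_rate \<mu>) T))"

lemma server_rate_pos: "A \<noteq> {} \<Longrightarrow> 0 < server_rate arr_rate \<S> A"
proof -
  assume "A \<noteq> {}"
  then obtain n where "n \<in> A" by blast
  moreover obtain S where "S \<in> \<S>" "n \<in> S" using covering by blast
  ultimately show ?thesis
    by (intro cover_rate_pos[of \<S> _ n A S]) (simp_all add: arrival_rate_pos)
qed

lemma server_rate_nonzero: "A \<noteq> {} \<Longrightarrow> server_rate arr_rate \<S> A \<noteq> 0"
  using server_rate_pos[of A] by simp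

lemma idle_weight_pos: "0 < idle_weight u"
  by (intro weight_pos \<mu>_pos server_rate_pos)

lemma pair_weight_nonneg: "x \<in> pair_states \<S> \<Longrightarrow> 0 \<le> pair_weight x"
  using stable_weight_nonneg[OF stable, of "fst x"] idle_weight_pos[of "snd x"]
  by (cases x) (simp add: pair_states_def)

text \<open>For a fixed idle word u the admissible waiting words are exactly those over the types
  avoiding u. Idle words are distinct and so finite in number; only the waiting word contributes an
  infinite sum.\<close>

lemma pair_has_sum:
  assumes "stable a' (job_rate \<mu>) \<S>"
  shows "((\<lambda>x. weight a' (job_rate \<mu>) (fst x) * idle_weight (snd x)) has_sum pair_sum a') (pair_states \<S>)"
proof -
  have "pair_states \<S> = (\<Union>u\<in>{u. distinct u}. (\<lambda>c. (c, u)) ` {c. set c \<subseteq> {S \<in> \<S>. S \<inter> set u = {}}})"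
    unfolding pair_states_def by fastforce
  moreover have "((\<lambda>x. weight a' (job_rate \<mu>) (fst x) * idle_weight (snd x)) has_sum
      idle_weight u * (\<Sum>T\<in>Pow {S \<in> \<S>. S \<inter> set u = {}}. level a' (job_rate \<mu>) T))
      ((\<lambda>c. (c, u)) ` {c. set c \<subseteq> {S \<in> \<S>. S \<inter> set u = {}}})" for u
  proof -
    have "(weight a' (job_rate \<mu>) has_sum (\<Sum>T\<in>Pow {S \<in> \<S>. S \<inter> set u = {}}. level a' (job_rate \<mu>) T))
        {c. set c \<subseteq> {S \<in> \<S>. S \<inter> set u = {}}}"
      by (intro weight_has_sum_lists stable_subset[OF assms]) auto
    from has_sum_cmult_left[OF this, of "idle_weight u"] show ?thesis
      by (subst has_sum_reindex) (simp_all add: inj_on_def o_def mult.commute)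
  qed
  ultimately show ?thesis
    by (auto intro!: sum_has_sum finite_distinct)
qed

lemma pair_sum_pos: "0 < pair_sum arr_rate"
proof (rule sum_pos)
  fix u :: "'n list"
  show "0 < idle_weight u * (\<Sum>T\<in>Pow {S \<in> \<S>. S \<inter> set u = {}}. level arr_rate (job_rate \<mu>) T)"
    by (rule mult_pos_pos[OF idle_weight_pos level_sum_pos]) blast
next
  show "{u :: 'n list. distinct u} \<noteq> {}" using distinct.simps(1) by blast
qed (rule finite_distinct)

lemma idle_rate_split:
  "(\<Sum>S | S \<in> \<S> \<and> S \<inter> A = {}. arr_rate S) = (\<Sum>S\<in>\<S>. arr_rate S) - server_rate arr_rate \<S> A"
proof -
  have "(\<Sum>S\<in>\<S>. arr_rate S) = (\<Sum>S | S \<in> \<S> \<and> S \<inter> A = {}. arr_rate S) + (\<Sum>S | S \<in> \<S> \<and> (\<exists>x\<in>A. x \<in> S). arr_rate S)"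
    by (subst sum.union_disjoint[symmetric]) (auto intro!: sum.cong)
  then show ?thesis by (simp add: cover_rate_def)
qed

text \<open>Arrivals lengthen the waiting word or shorten the idle word, so
  \<open>weight_snoc_balance\<close> applies to c and \<open>weight_removal_balance\<close> to u,
  with job types extracting servers.\<close>

lemma pair_arrival_inflow:
  assumes y: "(c, u) \<in> pair_states \<S>"
  shows "(\<Sum>S\<in>\<S>. arr_rate S * (\<Sum>x | x \<in> pair_states \<S> \<and> pair_arrival S x = (c, u). pair_weight x)) =
    (job_rate \<mu> (set c) + (\<Sum>n | n \<notin> set u \<and> (\<forall>T\<in>set c. n \<notin> T). \<mu> n)) * pair_weight (c, u)"
proof -
  let ?I = "{n. n \<notin> set u \<and> (\<forall>T\<in>set c. n \<notin> T)}"
  have "(\<Sum>x | x \<in> pair_states \<S> \<and> pair_arrival S x = (c, u). pair_weight x) =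
      (\<Sum>d | c = d @ [S]. coc_weight d) * idle_weight u +
      coc_weight c * (\<Sum>v\<in>removals ?I (\<lambda>n. n \<in> S) u. idle_weight v)" for S
    unfolding pair_arrival_preimage[OF y]
    by (subst sum.union_disjoint)
      (auto simp: finite_snoc_preimage finite_removals notin_removals sum.reindex inj_on_def
        sum_distrib_left sum_distrib_right)
  then have "(\<Sum>S\<in>\<S>. arr_rate S * (\<Sum>x | x \<in> pair_states \<S> \<and> pair_arrival S x = (c, u). pair_weight x)) =
      (\<Sum>S\<in>\<S>. arr_rate S * (\<Sum>d | c = d @ [S]. coc_weight d)) * idle_weight u +
      coc_weight c * (\<Sum>S\<in>\<S>. arr_rate S * (\<Sum>v\<in>removals ?I (\<lambda>n. n \<in> S) u. idle_weight v))"
    by (simp only: distrib_left sum.distrib sum_distrib_left sum_distrib_right mult_ac)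
  also have "(\<Sum>S\<in>\<S>. arr_rate S * (\<Sum>d | c = d @ [S]. coc_weight d)) = job_rate \<mu> (set c) * coc_weight c"
    using y by (intro weight_snoc_balance stable_rate_nonzero[OF stable]) (simp_all add: pair_states_def)
  also have "(\<Sum>S\<in>\<S>. arr_rate S * (\<Sum>v\<in>removals ?I (\<lambda>n. n \<in> S) u. idle_weight v)) =
      (\<Sum>n\<in>?I. \<mu> n) * idle_weight u"
    by (intro weight_removal_balance server_rate_nonzero) simp_all
  finally show ?thesis by (simp add: algebra_simps)
qed

text \<open>The two words exchange roles: completions shorten c or lengthen u. Appended servers
  contribute the arrival rate compatible with u, removals that of the types avoiding u, and together
  these make up the total arrival rate.\<close>

lemma pair_completion_inflow:
  assumes y: "(c, u) \<in> pair_states \<S>"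
  shows "(\<Sum>n\<in>UNIV. \<mu> n * (\<Sum>x | x \<in> pair_states \<S> \<and> pair_completion n x = (c, u). pair_weight x)) =
    ((\<Sum>n\<in>set u. \<mu> n) + (\<Sum>S\<in>\<S>. arr_rate S)) * pair_weight (c, u)"
proof -
  let ?I = "{S \<in> \<S>. S \<inter> set u = {}}"
  have notin: "(c, u) \<notin> Pair c ` {v. u = v @ [n]}" for n by auto
  have "(\<Sum>x | x \<in> pair_states \<S> \<and> pair_completion n x = (c, u). pair_weight x) =
      of_bool (n \<in> set u) * pair_weight (c, u) +
      coc_weight c * (\<Sum>v | u = v @ [n]. idle_weight v) +
      (\<Sum>d\<in>removals ?I (\<lambda>S. n \<in> S) c. coc_weight d) * idle_weight u" for n
  proof -
    have "(\<Sum>x | x \<in> pair_states \<S> \<and> pair_completion n x = (c, u). pair_weight x) =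
      (\<Sum>x\<in>(if n \<in> set u then {(c, u)} else {}). pair_weight x) +
      (\<Sum>x\<in>Pair c ` {v. u = v @ [n]}. pair_weight x) +
      (\<Sum>x\<in>(\<lambda>d. (d, u)) ` removals ?I (\<lambda>S. n \<in> S) c. pair_weight x)"
      unfolding pair_completion_preimage[OF y]
      by (subst sum.union_disjoint, simp_all add: finite_snoc_preimage finite_removals)
        (auto simp: notin_removals notin finite_snoc_preimage)
    then show ?thesis
      by (simp add: sum.reindex inj_on_def sum_distrib_left sum_distrib_right)
  qed
  then have "(\<Sum>n\<in>UNIV. \<mu> n * (\<Sum>x | x \<in> pair_states \<S> \<and> pair_completion n x = (c, u). pair_weight x)) =
      (\<Sum>n\<in>UNIV. \<mu> n * of_bool (n \<in> set u)) * pair_weight (c, u) +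
      coc_weight c * (\<Sum>n\<in>UNIV. \<mu> n * (\<Sum>v | u = v @ [n]. idle_weight v)) +
      (\<Sum>n\<in>UNIV. \<mu> n * (\<Sum>d\<in>removals ?I (\<lambda>S. n \<in> S) c. coc_weight d)) * idle_weight u"
    by (simp only: distrib_left sum.distrib sum_distrib_left sum_distrib_right mult_ac)
  also have "(\<Sum>n\<in>UNIV. \<mu> n * of_bool (n \<in> set u)) = (\<Sum>n\<in>set u. \<mu> n)"
    by (intro sum.mono_neutral_cong_right) auto
  also have "(\<Sum>n\<in>UNIV. \<mu> n * (\<Sum>v | u = v @ [n]. idle_weight v)) =
      server_rate arr_rate \<S> (set u) * idle_weight u"
    by (intro weight_snoc_balance server_rate_nonzero) simp_all
  also have "(\<Sum>n\<in>UNIV. \<mu> n * (\<Sum>d\<in>removals ?I (\<lambda>S. n \<in> S) c. coc_weight d)) =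
      (\<Sum>S\<in>?I. arr_rate S) * coc_weight c"
  proof (intro weight_removal_balance stable_rate_nonzero[OF stable])
    show "A \<subseteq> \<S>" if "A \<subseteq> ?I \<union> set c" for A
      using that y by (auto simp: pair_states_def)
  qed simp_all
  finally show ?thesis unfolding idle_rate_split by (simp add: algebra_simps)
qed

lemma pair_invariant:
  "invariant_pmf (event_pmf \<mu> \<S> p lam) (case_sum pair_arrival pair_completion)
    (normalized_pmf pair_weight (pair_states \<S>))"
proof (rule invariant_normalized_pmf)
  show "(pair_weight has_sum pair_sum arr_rate) (pair_states \<S>)" by (rule pair_has_sum[OF stable])
  show "0 < pair_sum arr_rate" by (rule pair_sum_pos)
  show "finite {x \<in> pair_states \<S>. pair_arrival S x = y}" if "y \<in> pair_states \<S>" for S y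
    using that by (cases y) (simp add: pair_arrival_preimage finite_snoc_preimage finite_removals)
  show "finite {x \<in> pair_states \<S>. pair_completion n x = y}" if "y \<in> pair_states \<S>" for n y
    using that by (cases y) (simp add: pair_completion_preimage finite_snoc_preimage finite_removals)
  fix y assume y: "y \<in> pair_states \<S>"
  obtain c u where [simp]: "y = (c, u)" by (cases y)
  \<comment> \<open>The busy servers that no waiting job can use. With the idle servers and the
    servers of the waiting types they partition all servers, so the two inflows add up to the total
    rate.\<close>
  define B where "B = {n. n \<notin> set u \<and> (\<forall>T\<in>set c. n \<notin> T)}"
  have "UNIV = (set u \<union> B) \<union> \<Union>(set c)" unfolding B_def by blast
  then have "(\<Sum>n\<in>UNIV. \<mu> n) = (\<Sum>n\<in>(set u \<union> B) \<union> \<Union>(set c). \<mu> n)" by simp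
  also have "\<dots> = (\<Sum>n\<in>set u \<union> B. \<mu> n) + (\<Sum>n\<in>\<Union>(set c). \<mu> n)"
    using y by (intro sum.union_disjoint) (auto simp: pair_states_def B_def)
  also have "(\<Sum>n\<in>set u \<union> B. \<mu> n) = (\<Sum>n\<in>set u. \<mu> n) + (\<Sum>n\<in>B. \<mu> n)"
    by (intro sum.union_disjoint) (auto simp: B_def)
  finally have "(\<Sum>n\<in>UNIV. \<mu> n) = (\<Sum>n\<in>set u. \<mu> n) + (\<Sum>n\<in>B. \<mu> n) + (\<Sum>n\<in>\<Union>(set c). \<mu> n)" .
  then have "total_rate \<mu> \<S> p lam = job_rate \<mu> (set c) + (\<Sum>n\<in>B. \<mu> n) +
      ((\<Sum>n\<in>set u. \<mu> n) + (\<Sum>S\<in>\<S>. arr_rate S))"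
    by (simp add: total_rate_def job_rate_eq)
  then show "total_rate \<mu> \<S> p lam * pair_weight y =
      (\<Sum>S\<in>\<S>. arr_rate S * (\<Sum>x | x \<in> pair_states \<S> \<and> pair_arrival S x = y. pair_weight x)) +
      (\<Sum>n\<in>UNIV. \<mu> n * (\<Sum>x | x \<in> pair_states \<S> \<and> pair_completion n x = y. pair_weight x))"
    using pair_arrival_inflow[of c u] pair_completion_inflow[of c u] y by (simp add: distrib_right B_def)
qed (simp_all only: pair_weight_nonneg pair_arrival_closed pair_completion_closed)

text \<open>The order of idleness belongs to the state. So arrivals make all servers busy,
  completions then drain the queue, and finally the servers go idle one by one in the prescribed
  order \<open>us\<close>.\<close>

lemma pair_reaches:
  assumes us: "distinct us" "set us = UNIV" and c: "set c \<subseteq> \<S>"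
  shows "reaches (set_pmf (event_pmf \<mu> \<S> p lam)) (case_sum pair_arrival pair_completion) ([], us) (c, u)"
    (is "?R (c, u)")
proof -
  have completion: "?R x" if "?R (pair_completion n x)" for n x
    by (rule reaches.further[of "Inr n"]) (use that in \<open>simp_all add: set_event_pmf\<close>)
  have arrival: "?R x" if "?R (pair_arrival S x)" "S \<in> \<S>" for S x
    by (rule reaches.further[of "Inl S"]) (use that in \<open>simp_all add: set_event_pmf\<close>)
  have fill: "?R ([], v)" if "us = v @ w" for v w
    using that
  proof (induction w arbitrary: v)
    case Nil
    then show ?case by (simp add: reaches.here)
  next
    case (Cons n w)
    then have "pair_completion n ([], v) = ([], v @ [n])"
      using us by (auto simp: extract_Nil_code)
    then show ?case using Cons completion[of n "([], v)"] by simp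
  qed
  have drain: "?R (c, [])" if "set c \<subseteq> \<S>" for c
    using that
  proof (induction c)
    case Nil
    then show ?case using fill[of "[]"] by simp
  next
    case (Cons S c)
    then obtain n where "n \<in> S" using nonempty_types by fastforce
    then have "pair_completion n (S # c, []) = (c, [])"
      by (simp add: extract_Cons_code)
    then show ?case using Cons completion[of n "(S # c, [])"] by simp
  qed
  show ?thesis
  proof (induction u)
    case Nil
    then show ?case by (rule drain[OF c])
  next
    case (Cons n u)
    obtain S where S: "S \<in> \<S>" "n \<in> S" using covering by blast
    then have "pair_arrival S (c, n # u) = (c, u)"
      by (simp add: extract_Cons_code)
    then show ?case using Cons arrival[of S "(c, n # u)"] S by simp
  qed
qed

lemma cos_stationary_product_form:
  assumes "cos_stationary \<mu> \<S> p lam \<pi>"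
  shows "map_pmf drop_served \<pi> = normalized_pmf pair_weight (pair_states \<S>)"
proof -
  obtain us :: "'n list" where us: "set us = UNIV" "distinct us"
    using finite_distinct_list[of "UNIV :: 'n set"] finite by blast
  show ?thesis
  proof (rule invariant_pmf_unique[where z="([], us)"])
    have "invariant_pmf (event_pmf \<mu> \<S> p lam) (case_sum cos_arrival cos_completion) \<pi>"
      using assms cos_arrival_closed cos_completion_closed unfolding cos_stationary_def
      by (rule stationary_imp_invariant)
    then show "invariant_pmf (event_pmf \<mu> \<S> p lam) (case_sum pair_arrival pair_completion) (map_pmf drop_served \<pi>)"
      by (rule invariant_pmf_map)
        (auto simp: drop_served_arrival drop_served_completion split: sum.split)
    show "finite (set_pmf (event_pmf \<mu> \<S> p lam))" by simp
    have "set_pmf \<pi> \<subseteq> cos_states \<S>" using assms by (simp add: cos_stationary_def stationary_def)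
    then have "set_pmf (map_pmf drop_served \<pi>) \<subseteq> pair_states \<S>"
      using drop_served_states unfolding set_map_pmf by blast
    moreover have "set_pmf (normalized_pmf pair_weight (pair_states \<S>)) \<subseteq> pair_states \<S>"
      by (rule set_normalized_pmf[OF pair_has_sum[OF stable] pair_sum_pos pair_weight_nonneg])
    ultimately show "reaches (set_pmf (event_pmf \<mu> \<S> p lam)) (case_sum pair_arrival pair_completion) ([], us) x"
      if "x \<in> set_pmf (map_pmf drop_served \<pi>) \<union> set_pmf (normalized_pmf pair_weight (pair_states \<S>))" for x
    proof -
      have "x \<in> pair_states \<S>"
        using that \<open>set_pmf (map_pmf drop_served \<pi>) \<subseteq> _\<close> \<open>set_pmf (normalized_pmf _ _) \<subseteq> _\<close> by blast
      then show ?thesis by (cases x) (auto simp: pair_states_def intro!: pair_reaches us)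
    qed
  qed (rule pair_invariant)
qed

lemma cos_transform:
  assumes "cos_stationary \<mu> \<S> p lam \<pi>" and z: "\<And>S. 0 \<le> z S \<and> z S \<le> 1"
  shows "measure_pmf.expectation \<pi> (\<lambda>x. prod_list (map z (fst x))) =
    pair_sum (\<lambda>S. arr_rate S * z S) / pair_sum arr_rate"
proof -
  have "measure_pmf.expectation \<pi> (\<lambda>x. prod_list (map z (fst x))) =
      measure_pmf.expectation (map_pmf drop_served \<pi>) (\<lambda>x. prod_list (map z (fst x)))"
    by (simp add: drop_served_def case_prod_beta)
  also have "\<dots> = pair_sum (\<lambda>S. arr_rate S * z S) / pair_sum arr_rate"
    unfolding cos_stationary_product_form[OF assms(1)]
  proof (rule expectation_normalized_pmf[OF pair_has_sum[OF stable] pair_sum_pos pair_weight_nonneg])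
    have "((\<lambda>x. weight (\<lambda>S. arr_rate S * z S) (job_rate \<mu>) (fst x) * idle_weight (snd x)) has_sum
      pair_sum (\<lambda>S. arr_rate S * z S)) (pair_states \<S>)"
      by (rule pair_has_sum[OF stable_mult[OF stable z]])
    then show "((\<lambda>x. pair_weight x * prod_list (map z (fst x))) has_sum
      pair_sum (\<lambda>S. arr_rate S * z S)) (pair_states \<S>)"
      unfolding weight_mult by (simp only: mult_ac)
    show "0 \<le> prod_list (map z (fst x))" for x :: "'n set list \<times> 'n list"
      using z by (intro prod_list_nonneg) auto
  qed
  finally show ?thesis .
qed

end

section \<open>Heavy traffic\<close>

lemma avg_speed_card: "real CARD('n) * avg_speed \<mu> = (\<Sum>n\<in>UNIV. \<mu> n)" for \<mu> :: "'n::finite \<Rightarrow> real"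
  by (simp add: avg_speed_def)

section \<open>Equivalence of the two forms of local stability\<close>

locale replication_system =
  fixes \<mu> :: "'n::finite \<Rightarrow> real" and \<S> :: "'n set set" and p :: "'n set \<Rightarrow> real"
  assumes \<mu>_pos: "\<And>n. 0 < \<mu> n"
    and types_nonempty: "\<S> \<noteq> {}"
    and nonempty_types: "{} \<notin> \<S>"
    and covering: "\<Union>\<S> = UNIV"
    and p_pos: "\<And>S. S \<in> \<S> \<Longrightarrow> 0 < p S"
    and p_sum: "(\<Sum>S\<in>\<S>. p S) = 1"
begin

lemma total_speed_pos: "0 < (\<Sum>n\<in>UNIV. \<mu> n)"
  using \<mu>_pos by (intro sum_pos) auto

lemma avg_speed_pos: "0 < avg_speed \<mu>"
  using total_speed_pos by (simp add: avg_speed_def)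

lemma p_sum_mono: "A \<subseteq> B \<Longrightarrow> B \<subseteq> \<S> \<Longrightarrow> sum p A \<le> sum p B"
  using p_pos by (intro sum_mono2) (auto intro: less_imp_le)

lemma p_sum_strict: "A \<subset> \<S> \<Longrightarrow> sum p A < 1"
proof -
  assume A: "A \<subset> \<S>"
  then obtain S where "S \<in> \<S>" "S \<notin> A" by blast
  then have "sum p A < sum p \<S>"
    using A p_pos by (intro sum_strict_mono2[of _ _ S]) (auto intro: less_imp_le)
  then show ?thesis by (simp add: p_sum)
qed

lemma local_stabilityD:
  "local_stability \<mu> \<S> p \<Longrightarrow> T \<noteq> {} \<Longrightarrow> T \<subset> \<S> \<Longrightarrow> sum p T < 1 / sum \<mu> UNIV * sum \<mu> (\<Union>T)"
  unfolding local_stability_def avg_speed_card by simp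

lemma local_stability_serversD:
  "local_stability_servers \<mu> \<S> p \<Longrightarrow> U \<noteq> {} \<Longrightarrow> U \<subset> UNIV \<Longrightarrow>
    sum p {S \<in> \<S>. S \<subseteq> U} < 1 / sum \<mu> UNIV * sum \<mu> U"
  unfolding local_stability_servers_def avg_speed_card by simp

text \<open>From types to servers, take the types contained in U: their union lies in U, by
  \<open>covering\<close> they are not all types, and if there are none the left side is 0. From
  servers to types, take U = \<Union>\<T>; if this contains every server, strictness comes from a
  type of positive probability missing in \<T>.\<close>

lemma local_stability_iff: "local_stability \<mu> \<S> p \<longleftrightarrow> local_stability_servers \<mu> \<S> p"
proof
  assume types: "local_stability \<mu> \<S> p"
  show "local_stability_servers \<mu> \<S> p"
    unfolding local_stability_servers_def avg_speed_card
  proof (intro allI impI, elim conjE)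
    fix U :: "'n set" assume U: "U \<noteq> {}" "U \<subset> UNIV"
    have pos: "0 < sum \<mu> U" using U \<mu>_pos by (intro sum_pos) auto
    show "sum p {S \<in> \<S>. S \<subseteq> U} < 1 / sum \<mu> UNIV * sum \<mu> U"
    proof (cases "{S \<in> \<S>. S \<subseteq> U} = {}")
      case True
      then have "sum p {S \<in> \<S>. S \<subseteq> U} = 0" by (simp only: sum.empty)
      then show ?thesis using pos total_speed_pos by simp
    next
      case False
      have "{S \<in> \<S>. S \<subseteq> U} \<subset> \<S>" using U(2) covering by blast
      then have "sum p {S \<in> \<S>. S \<subseteq> U} < 1 / sum \<mu> UNIV * sum \<mu> (\<Union>{S \<in> \<S>. S \<subseteq> U})"
        by (rule local_stabilityD[OF types False])
      also have "\<dots> \<le> 1 / sum \<mu> UNIV * sum \<mu> U"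
        using total_speed_pos \<mu>_pos by (intro mult_left_mono sum_mono2) (auto intro: less_imp_le)
      finally show ?thesis .
    qed
  qed
next
  assume servers: "local_stability_servers \<mu> \<S> p"
  show "local_stability \<mu> \<S> p"
    unfolding local_stability_def avg_speed_card
  proof (intro allI impI, elim conjE)
    fix \<T> assume T: "\<T> \<noteq> {}" "\<T> \<subset> \<S>"
    show "sum p \<T> < 1 / sum \<mu> UNIV * sum \<mu> (\<Union>\<T>)"
    proof (cases "\<Union>\<T> = UNIV")
      case True
      then show ?thesis using p_sum_strict[OF T(2)] total_speed_pos by simp
    next
      case False
      have "sum p \<T> \<le> sum p {S \<in> \<S>. S \<subseteq> \<Union>\<T>}"
        using T by (intro p_sum_mono) auto
      also have "\<dots> < 1 / sum \<mu> UNIV * sum \<mu> (\<Union>\<T>)"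
      proof -
        obtain S where S: "S \<in> \<T>" using T(1) by (auto simp: ex_in_conv[symmetric])
        then have "S \<noteq> {}" using T(2) nonempty_types by (auto simp: psubset_eq)
        then have "\<Union>\<T> \<noteq> {}" using S by auto
        moreover have "\<Union>\<T> \<subset> UNIV" using False by blast
        ultimately show ?thesis by (rule local_stability_serversD[OF servers])
      qed
      finally show ?thesis .
    qed
  qed
qed

end

section \<open>Laplace transforms of job counts and of the exponential law\<close>

lemma prod_list_exp_count:
  fixes k :: "'a::finite \<Rightarrow> real"
  shows "prod_list (map (\<lambda>S. exp (- e * k S)) c) = exp (- e * (\<Sum>S\<in>UNIV. k S * real (count_list c S)))"
proof (induction c)
  case (Cons x c)
  have "(\<Sum>S\<in>UNIV. k S * real (count_list (x # c) S)) =
      (\<Sum>S\<in>UNIV. k S * real (count_list c S) + (if x = S then k S else 0))"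
    by (intro sum.cong) (auto simp: algebra_simps)
  also have "\<dots> = (\<Sum>S\<in>UNIV. k S * real (count_list c S)) + k x"
    by (simp add: sum.distrib)
  finally show ?case using Cons by (simp add: exp_add[symmetric] algebra_simps)
qed simp

lemma orthant_prob_distr:
  fixes f :: "'s \<Rightarrow> real ^ 'k::finite"
  assumes "prob_space M" "f \<in> borel_measurable M" "AE x in M. \<forall>j. 0 \<le> f x $ j"
  shows "orthant_prob (distr M borel f)"
proof (rule orthant_prob.intro)
  show "sets (distr M borel f) = sets borel" by simp
  show "prob_space (distr M borel f)" using assms by (intro prob_space.prob_space_distr)
  have "closed {x :: real ^ 'k. \<forall>j. 0 \<le> x $ j}"
    by (intro closed_Collect_all closed_Collect_le continuous_intros)
  then have "{x :: real ^ 'k. \<forall>j. 0 \<le> x $ j} \<in> sets borel" by (rule borel_closed)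
  then show "AE x in distr M borel f. \<forall>j. 0 \<le> x $ j"
    using assms by (subst AE_distr_iff) simp_all
qed

lemma laplace_measurable [measurable]:
  "(\<lambda>x :: real ^ 'k::finite. exp (- (\<Sum>j\<in>UNIV. real (k j) * x $ j))) \<in> borel_measurable borel"
  by (intro borel_measurable_continuous_onI continuous_intros)

text \<open>The unit-rate density times exp (- t s) is the density of rate 1 + s divided by 1 + s,
  and that density integrates to 1.\<close>

lemma exponential_laplace:
  assumes "0 \<le> (s::real)"
  shows "(\<integral>t. exp (- (t * s)) \<partial>density lborel (\<lambda>t. ennreal (exponential_density 1 t))) = 1 / (1 + s)"
proof -
  have int: "(\<integral>t. exponential_density (1 + s) t \<partial>lborel) = 1"
  proof -
    interpret prob_space "density lborel (exponential_density (1 + s))"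
      using assms by (intro prob_space_exponential_density) simp
    have "(1::real) = (\<integral>t. 1 \<partial>density lborel (\<lambda>t. ennreal (exponential_density (1 + s) t)))"
      using prob_space by simp
    also have "\<dots> = (\<integral>t. exponential_density (1 + s) t \<partial>lborel)"
      using assms by (subst integral_density) (auto intro!: exponential_density_nonneg)
    finally show ?thesis by simp
  qed
  have "(\<integral>t. exp (- (t * s)) \<partial>density lborel (\<lambda>t. ennreal (exponential_density 1 t))) =
      (\<integral>t. exponential_density 1 t * exp (- (t * s)) \<partial>lborel)"
    by (subst integral_density) (auto intro!: exponential_density_nonneg)
  also have "\<dots> = (\<integral>t. exponential_density (1 + s) t / (1 + s) \<partial>lborel)"
  proof (rule Bochner_Integration.integral_cong)
    fix t :: real
    have "exp (- t) * exp (- (t * s)) = exp (- t * (1 + s))"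
      by (simp add: exp_add[symmetric] algebra_simps)
    then show "exponential_density 1 t * exp (- (t * s)) = exponential_density (1 + s) t / (1 + s)"
      using assms by (simp add: exponential_density_def)
  qed simp
  also have "\<dots> = 1 / (1 + s)" using int by simp
  finally show ?thesis .
qed

text \<open>This is the derivative at 0 of -(1 - e) exp (- e k), whose value there is -1. In the
  limit, 1 comes from the reduced load and k from the tilt.\<close>

lemma exp_difference_quotient:
  "((\<lambda>e :: real. (1 - (1 - e) * exp (- e * k)) / e) \<longlongrightarrow> 1 + k) (at 0)"
proof -
  have "((\<lambda>e. - ((1 - e) * exp (- e * k))) has_field_derivative 1 + k) (at 0)"
    by (auto intro!: derivative_eq_intros)
  then show ?thesis by (simp add: has_field_derivative_iff)
qed

section \<open>Limits of the generating functions at critical load\<close>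

locale heavy_traffic = replication_system \<mu> \<S> p
  for \<mu> :: "'n::finite \<Rightarrow> real" and \<S> :: "'n set set" and p :: "'n set \<Rightarrow> real" +
  assumes local_stability: "local_stability \<mu> \<S> p"
begin

definition slack :: "real \<Rightarrow> real" where
  "slack lam = 1 - lam / avg_speed \<mu>"

definition tilt :: "('n set \<Rightarrow> nat) \<Rightarrow> real \<Rightarrow> 'n set \<Rightarrow> real" where
  "tilt k lam = (\<lambda>S. exp (- slack lam * real (k S)))"

definition critical_rate :: "'n set \<Rightarrow> real" where
  "critical_rate S = real CARD('n) * avg_speed \<mu> * p S"

abbreviation "rate k lam \<equiv> \<lambda>S. real CARD('n) * lam * p S * tilt k lam S"
abbreviation "\<F> \<equiv> at_left (avg_speed \<mu>)"
abbreviation "dot k \<equiv> (\<Sum>S\<in>\<S>. p S * real (k S))"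

lemma subcritical: "eventually (\<lambda>lam. lam \<in> {0<..<avg_speed \<mu>}) \<F>"
  by (rule eventually_at_left_real[OF avg_speed_pos])

lemma slack_range: "lam \<in> {0<..<avg_speed \<mu>} \<Longrightarrow> 0 < slack lam \<and> slack lam < 1"
  using avg_speed_pos by (auto simp: slack_def)

lemma slack_tendsto: "(slack \<longlongrightarrow> 0) \<F>"
proof -
  have "(slack \<longlongrightarrow> 1 - avg_speed \<mu> / avg_speed \<mu>) \<F>"
    unfolding slack_def using avg_speed_pos by (intro tendsto_intros) auto
  then show ?thesis using avg_speed_pos by simp
qed

lemma slack_at_0: "filterlim slack (at 0) \<F>"
  unfolding filterlim_at
proof
  show "eventually (\<lambda>lam. slack lam \<in> UNIV \<and> slack lam \<noteq> 0) \<F>"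
    using subcritical
  proof eventually_elim
    case (elim lam)
    then show ?case using slack_range[OF elim] by simp
  qed
qed (rule slack_tendsto)

lemma tilt_range: "lam \<in> {0<..<avg_speed \<mu>} \<Longrightarrow> 0 \<le> tilt k lam S \<and> tilt k lam S \<le> 1"
  using slack_range[of lam] by (auto simp: tilt_def)

lemma stable_critical: "T \<subset> \<S> \<Longrightarrow> stable critical_rate (job_rate \<mu>) T"
  unfolding stable_def
proof (intro conjI ballI allI impI)
  assume T: "T \<subset> \<S>"
  show "0 \<le> critical_rate S" if "S \<in> T" for S
    using that T avg_speed_pos p_pos[of S] by (auto simp: critical_rate_def)
  fix A assume A: "A \<subseteq> T" "A \<noteq> {}"
  then have "sum p A < 1 / sum \<mu> UNIV * sum \<mu> (\<Union>A)"
    using T by (intro local_stabilityD[OF local_stability]) auto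
  then have "sum \<mu> UNIV * sum p A < sum \<mu> (\<Union>A)"
    using total_speed_pos by (simp add: field_simps)
  then show "sum critical_rate A < job_rate \<mu> A"
    by (simp add: critical_rate_def avg_speed_card job_rate_eq sum_distrib_left)
qed

text \<open>Strictness comes from \<lambda> lying below the critical value, so a weak inequality
  suffices at criticality. There the full set of types gives equality, and local stability covers
  the other sets.\<close>

lemma stable_queue:
  assumes "lam \<in> {0<..<avg_speed \<mu>}"
  shows "stable_queue \<mu> \<S> p lam"
proof
  show "stable (\<lambda>S. real CARD('n) * lam * p S) (job_rate \<mu>) \<S>"
    unfolding stable_def
  proof (intro conjI ballI allI impI)
    show "0 \<le> real CARD('n) * lam * p S" if "S \<in> \<S>" for S
      using that assms p_pos[of S] by auto
    fix A assume A: "A \<subseteq> \<S>" "A \<noteq> {}"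
    have pA: "0 < sum p A" using A p_pos by (intro sum_pos) auto
    have "(\<Sum>S\<in>A. real CARD('n) * lam * p S) = real CARD('n) * lam * sum p A"
      by (simp add: sum_distrib_left)
    also have "\<dots> < real CARD('n) * avg_speed \<mu> * sum p A"
      using assms pA by (intro mult_strict_right_mono mult_strict_left_mono) auto
    also have "\<dots> \<le> job_rate \<mu> A"
    proof (cases "A = \<S>")
      case True
      then show ?thesis using covering p_sum by (simp add: avg_speed_card job_rate_eq)
    next
      case False
      then have "sum critical_rate A < job_rate \<mu> A"
        using stable_critical[of A] A by (simp add: stable_def psubset_eq)
      then show ?thesis by (simp add: critical_rate_def sum_distrib_left)
    qed
    finally show "(\<Sum>S\<in>A. real CARD('n) * lam * p S) < job_rate \<mu> A" .
  qed
qed (use assms \<mu>_pos p_pos nonempty_types covering in auto)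

lemma stable_rate:
  assumes "lam \<in> {0<..<avg_speed \<mu>}"
  shows "stable (rate k lam) (job_rate \<mu>) \<S>"
  by (rule stable_mult[OF stable_queue.stable[OF stable_queue[OF assms]] tilt_range[OF assms]])

lemma rate_tendsto: "((\<lambda>lam. rate k lam S) \<longlongrightarrow> critical_rate S) \<F>"
proof -
  have "((\<lambda>lam. tilt k lam S) \<longlongrightarrow> exp (- 0 * real (k S))) \<F>"
    unfolding tilt_def by (intro tendsto_intros slack_tendsto)
  then have "((\<lambda>lam. rate k lam S) \<longlongrightarrow> real CARD('n) * avg_speed \<mu> * p S * exp (- 0 * real (k S))) \<F>"
    by (intro tendsto_mult tendsto_const tendsto_ident_at)
  then show ?thesis by (simp add: critical_rate_def)
qed

lemma level_rate_tendsto: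
  assumes "T \<subset> \<S>"
  shows "((\<lambda>lam. level (rate k lam) (job_rate \<mu>) T) \<longlongrightarrow> level critical_rate (job_rate \<mu>) T) \<F>"
proof (rule level_tendsto)
  show "eventually (\<lambda>lam. stable (rate k lam) (job_rate \<mu>) T) \<F>"
    using subcritical by eventually_elim (rule stable_subset[OF stable_rate], use assms in auto)
qed (use assms in \<open>auto intro: rate_tendsto stable_critical\<close>)

text \<open>The right side of \<open>level_rec\<close> for the full set of types at critical rates.
  It involves strict subsets only, whose levels stay finite there.\<close>

definition top_flow :: real where
  "top_flow = (\<Sum>S\<in>\<S>. critical_rate S * level critical_rate (job_rate \<mu>) (\<S> - {S}))"

lemma top_flow_pos: "0 < top_flow"
  unfolding top_flow_def
proof (rule sum_pos)
  fix S assume S: "S \<in> \<S>"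
  have crit: "0 < critical_rate S" if "S \<in> \<S>" for S
    unfolding critical_rate_def using avg_speed_pos p_pos[OF that] by simp
  have "0 < level critical_rate (job_rate \<mu>) (\<S> - {S})"
  proof (rule level_pos)
    show "stable critical_rate (job_rate \<mu>) (\<S> - {S})" using S by (intro stable_critical) auto
  qed (auto intro: crit)
  then show "0 < critical_rate S * level critical_rate (job_rate \<mu>) (\<S> - {S})"
    using crit[OF S] by simp
qed (use types_nonempty in auto)

text \<open>The denominator of the recursion for the full set of types is the only one that vanishes in
  the limit, and it does so linearly in the slack.\<close>

lemma gap_tendsto:
  "((\<lambda>lam. (job_rate \<mu> \<S> - sum (rate k lam) \<S>) / slack lam) \<longlongrightarrow>
    sum \<mu> UNIV * (1 + dot k)) \<F>"
proof -
  have "((\<lambda>lam. sum \<mu> UNIV * (\<Sum>S\<in>\<S>. p S * ((1 - (1 - slack lam) * exp (- slack lam * real (k S))) / slack lam)))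
      \<longlongrightarrow> sum \<mu> UNIV * (\<Sum>S\<in>\<S>. p S * (1 + real (k S)))) \<F>"
    by (intro tendsto_mult tendsto_const tendsto_sum
        filterlim_compose[OF exp_difference_quotient slack_at_0])
  moreover have "sum \<mu> UNIV * (\<Sum>S\<in>\<S>. p S * ((1 - (1 - slack lam) * exp (- slack lam * real (k S))) / slack lam))
      = (job_rate \<mu> \<S> - sum (rate k lam) \<S>) / slack lam" for lam
  proof -
    define M where "M = sum \<mu> UNIV"
    \<comment> \<open>N times the average speed is the total speed, so the load is the total speed
      times 1 - slack. This brings in the difference quotient type by type.\<close>
    have lam: "real CARD('n) * lam = sum \<mu> UNIV * (1 - slack lam)"
      using avg_speed_pos by (simp add: slack_def avg_speed_card[symmetric])
    have "job_rate \<mu> \<S> - sum (rate k lam) \<S> =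
        M * (\<Sum>S\<in>\<S>. p S) - (\<Sum>S\<in>\<S>. M * (1 - slack lam) * p S * tilt k lam S)"
      unfolding lam p_sum by (simp add: job_rate_eq covering M_def)
    also have "\<dots> = M * (\<Sum>S\<in>\<S>. p S * (1 - (1 - slack lam) * tilt k lam S))"
      by (simp add: sum_distrib_left sum_subtractf sum.distrib algebra_simps)
    finally have eq: "job_rate \<mu> \<S> - sum (rate k lam) \<S> =
        sum \<mu> UNIV * (\<Sum>S\<in>\<S>. p S * (1 - (1 - slack lam) * tilt k lam S))"
      by (simp only: M_def)
    show ?thesis
      unfolding eq by (simp only: tilt_def times_divide_eq_right sum_divide_distrib[symmetric])
  qed
  moreover have "(\<Sum>S\<in>\<S>. p S * (1 + real (k S))) = 1 + dot k"
    by (simp add: distrib_left sum.distrib p_sum)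
  ultimately show ?thesis by simp
qed

lemma dot_nonneg: "0 \<le> dot k"
  using p_pos by (intro sum_nonneg) (simp add: less_imp_le)

definition top_limit :: "('n set \<Rightarrow> nat) \<Rightarrow> real" where
  "top_limit k = top_flow / (sum \<mu> UNIV * (1 + dot k))"

lemma top_level_tendsto:
  "((\<lambda>lam. slack lam * level (rate k lam) (job_rate \<mu>) \<S>) \<longlongrightarrow> top_limit k) \<F>"
proof -
  have "((\<lambda>lam. (\<Sum>S\<in>\<S>. rate k lam S * level (rate k lam) (job_rate \<mu>) (\<S> - {S})) /
      ((job_rate \<mu> \<S> - sum (rate k lam) \<S>) / slack lam)) \<longlongrightarrow> top_limit k) \<F>"
    unfolding top_limit_def top_flow_def
  proof (intro tendsto_divide tendsto_sum tendsto_mult[OF rate_tendsto] gap_tendsto)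
    show "((\<lambda>lam. level (rate k lam) (job_rate \<mu>) (\<S> - {S})) \<longlongrightarrow>
        level critical_rate (job_rate \<mu>) (\<S> - {S})) \<F>" if "S \<in> \<S>" for S
      using that by (intro level_rate_tendsto) auto
    show "sum \<mu> UNIV * (1 + dot k) \<noteq> 0"
      using total_speed_pos dot_nonneg[of k] by simp
  qed
  moreover have "eventually (\<lambda>lam. (\<Sum>S\<in>\<S>. rate k lam S * level (rate k lam) (job_rate \<mu>) (\<S> - {S})) /
      ((job_rate \<mu> \<S> - sum (rate k lam) \<S>) / slack lam) =
      slack lam * level (rate k lam) (job_rate \<mu>) \<S>) \<F>"
    using subcritical
  proof eventually_elim
    case (elim lam)
    have st: "stable (rate k lam) (job_rate \<mu>) \<S>" using elim by (rule stable_rate)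
    have gap: "job_rate \<mu> \<S> - sum (rate k lam) \<S> \<noteq> 0"
      using stable_total(1)[OF st types_nonempty] by simp
    have rec: "(\<Sum>S\<in>\<S>. rate k lam S * level (rate k lam) (job_rate \<mu>) (\<S> - {S})) =
        (job_rate \<mu> \<S> - sum (rate k lam) \<S>) * level (rate k lam) (job_rate \<mu>) \<S>"
      by (rule level_rec[OF _ st types_nonempty, symmetric]) simp
    show ?case
      unfolding rec using gap slack_range[OF elim] by simp
  qed
  ultimately show ?thesis by (rule Lim_transform_eventually)
qed

text \<open>Levels of strict subsets converge, so the slack factor removes them; the term of the
  full set occurs only if I is everything. General I serves the types avoiding a given idle
  word.\<close>

lemma level_sum_tendsto:
  assumes "I \<subseteq> \<S>"
  shows "((\<lambda>lam. slack lam * (\<Sum>T\<in>Pow I. level (rate k lam) (job_rate \<mu>) T)) \<longlongrightarrow>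
    of_bool (I = \<S>) * top_limit k) \<F>"
proof -
  have "((\<lambda>lam. slack lam * level (rate k lam) (job_rate \<mu>) T) \<longlongrightarrow>
      (if T = \<S> then top_limit k else 0)) \<F>" if "T \<in> Pow I" for T
  proof (cases "T = \<S>")
    case True
    then show ?thesis using top_level_tendsto by simp
  next
    case False
    then have "T \<subset> \<S>" using that assms by blast
    then show ?thesis using False tendsto_mult[OF slack_tendsto level_rate_tendsto, of T k] by simp
  qed
  then have "((\<lambda>lam. \<Sum>T\<in>Pow I. slack lam * level (rate k lam) (job_rate \<mu>) T) \<longlongrightarrow>
      (\<Sum>T\<in>Pow I. if T = \<S> then top_limit k else 0)) \<F>"
    by (rule tendsto_sum)
  moreover have "(\<Sum>T\<in>Pow I. if T = \<S> then top_limit k else 0) = of_bool (I = \<S>) * top_limit k"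
    using assms by (auto simp: sum.delta')
  ultimately show ?thesis by (simp add: sum_distrib_left)
qed

text \<open>Multiplying both parts of the quotient by the slack gives them finite limits. The
  constants V, \<open>top_flow\<close> and the total speed occur in both and cancel, and
  \<open>dot\<close> is 0 at k = 0.\<close>

lemma ratio_tendsto:
  assumes lim: "\<And>k. ((\<lambda>lam. slack lam * G k lam) \<longlongrightarrow> V * top_limit k) \<F>" and V: "0 < V"
  shows "((\<lambda>lam. G k lam / G (\<lambda>_. 0) lam) \<longlongrightarrow> 1 / (1 + dot k)) \<F>"
proof -
  have nz: "1 + dot k \<noteq> 0" for k using dot_nonneg[of k] by linarith
  have "V * top_limit (\<lambda>_. 0) \<noteq> 0"
    using V top_flow_pos total_speed_pos by (simp add: top_limit_def)
  then have "((\<lambda>lam. (slack lam * G k lam) / (slack lam * G (\<lambda>_. 0) lam)) \<longlongrightarrow>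
      V * top_limit k / (V * top_limit (\<lambda>_. 0))) \<F>"
    by (intro tendsto_divide lim)
  moreover have "V * top_limit k / (V * top_limit (\<lambda>_. 0)) = 1 / (1 + dot k)"
  proof -
    define D where "D = 1 + dot k"
    have "top_limit k = top_flow / (sum \<mu> UNIV * D)" "top_limit (\<lambda>_. 0) = top_flow / sum \<mu> UNIV"
      by (simp_all add: top_limit_def D_def)
    then show ?thesis
      using V top_flow_pos total_speed_pos nz[of k] unfolding D_def[symmetric] by simp
  qed
  moreover have "eventually (\<lambda>lam. (slack lam * G k lam) / (slack lam * G (\<lambda>_. 0) lam) = G k lam / G (\<lambda>_. 0) lam) \<F>"
    using subcritical
  proof eventually_elim
    case (elim lam)
    then show ?case using slack_range[OF elim] by simp
  qed
  ultimately show ?thesis by (simp add: tendsto_cong)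
qed

lemma rate_0: "rate (\<lambda>_. 0) lam = (\<lambda>S. real CARD('n) * lam * p S)"
  by (simp add: tilt_def)

lemma coc_transform_tendsto:
  assumes "\<And>lam. lam \<in> {0<..<avg_speed \<mu>} \<Longrightarrow> coc_stationary \<mu> \<S> p lam (\<pi> lam)"
  shows "((\<lambda>lam. measure_pmf.expectation (\<pi> lam) (\<lambda>c. prod_list (map (tilt k lam) c))) \<longlongrightarrow>
    1 / (1 + dot k)) \<F>"
proof -
  define G where "G k lam = (\<Sum>T\<in>Pow \<S>. level (rate k lam) (job_rate \<mu>) T)" for k lam
  have "((\<lambda>lam. G k lam / G (\<lambda>_. 0) lam) \<longlongrightarrow> 1 / (1 + dot k)) \<F>"
  proof (rule ratio_tendsto[where V=1])
    show "((\<lambda>lam. slack lam * G k lam) \<longlongrightarrow> 1 * top_limit k) \<F>" for k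
      unfolding G_def using level_sum_tendsto[of \<S> k] by simp
  qed simp
  moreover have "eventually (\<lambda>lam. G k lam / G (\<lambda>_. 0) lam =
      measure_pmf.expectation (\<pi> lam) (\<lambda>c. prod_list (map (tilt k lam) c))) \<F>"
    using subcritical
  proof eventually_elim
    case (elim lam)
    show ?case
      unfolding G_def rate_0
      by (rule stable_queue.coc_transform[OF stable_queue[OF elim] assms[OF elim] tilt_range[OF elim], symmetric])
  qed
  ultimately show ?thesis by (rule Lim_transform_eventually)
qed

lemma idle_weight_tendsto:
  "((\<lambda>lam. weight \<mu> (server_rate (\<lambda>S. real CARD('n) * lam * p S) \<S>) u) \<longlongrightarrow>
    weight \<mu> (server_rate critical_rate \<S>) u) \<F>"
  unfolding weight_def
proof (intro tendsto_prod tendsto_divide tendsto_const)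
  fix i assume i: "i \<in> {..<length u}"
  let ?A = "set (take (Suc i) u)"
  show "((\<lambda>lam. server_rate (\<lambda>S. real CARD('n) * lam * p S) \<S> ?A) \<longlongrightarrow>
      server_rate critical_rate \<S> ?A) \<F>"
    unfolding cover_rate_def
  proof (rule tendsto_sum)
    show "((\<lambda>lam. real CARD('n) * lam * p S) \<longlongrightarrow> critical_rate S) \<F>" for S
      unfolding critical_rate_def by (intro tendsto_mult tendsto_const tendsto_ident_at)
  qed
  have "u ! i \<in> ?A" using i by (simp add: take_Suc_conv_app_nth)
  moreover obtain S where "S \<in> \<S>" "u ! i \<in> S" using covering by blast
  ultimately have "0 < server_rate critical_rate \<S> ?A"
    using avg_speed_pos p_pos by (intro cover_rate_pos[of \<S> _ "u ! i" _ S]) (auto simp: critical_rate_def)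
  then show "server_rate critical_rate \<S> ?A \<noteq> 0" by simp
qed

lemma cos_transform_tendsto:
  assumes "\<And>lam. lam \<in> {0<..<avg_speed \<mu>} \<Longrightarrow> cos_stationary \<mu> \<S> p lam (\<pi> lam)"
  shows "((\<lambda>lam. measure_pmf.expectation (\<pi> lam) (\<lambda>x. prod_list (map (tilt k lam) (fst x)))) \<longlongrightarrow>
    1 / (1 + dot k)) \<F>"
proof -
  let ?I = "\<lambda>u. {S \<in> \<S>. S \<inter> set u = {}}"
  define W where "W lam u = weight \<mu> (server_rate (\<lambda>S. real CARD('n) * lam * p S) \<S>) u" for lam u
  define G where "G k lam = (\<Sum>u | distinct u. W lam u * (\<Sum>T\<in>Pow (?I u). level (rate k lam) (job_rate \<mu>) T))" for k lam
  define W\<^sub>0 where "W\<^sub>0 u = weight \<mu> (server_rate critical_rate \<S>) u" for u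
  \<comment> \<open>Only idle words compatible with no type keep the full set of types, hence a
    diverging level sum. The empty word is one of them and contributes 1, which makes V
    positive.\<close>
  define V where "V = (\<Sum>u | distinct u. W\<^sub>0 u * of_bool (?I u = \<S>))"
  have "((\<lambda>lam. G k lam / G (\<lambda>_. 0) lam) \<longlongrightarrow> 1 / (1 + dot k)) \<F>"
  proof (rule ratio_tendsto[where V=V])
    show "((\<lambda>lam. slack lam * G k lam) \<longlongrightarrow> V * top_limit k) \<F>" for k
    proof -
      have "((\<lambda>lam. \<Sum>u | distinct u. W lam u * (slack lam * (\<Sum>T\<in>Pow (?I u). level (rate k lam) (job_rate \<mu>) T)))
          \<longlongrightarrow> (\<Sum>u | distinct u. W\<^sub>0 u * (of_bool (?I u = \<S>) * top_limit k))) \<F>"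
        unfolding W_def W\<^sub>0_def
        by (intro tendsto_sum tendsto_mult idle_weight_tendsto level_sum_tendsto) auto
      then show ?thesis
        by (simp only: G_def V_def sum_distrib_left sum_distrib_right mult_ac)
    qed
    have pos: "0 \<le> W\<^sub>0 u" for u
      using idle_weight_tendsto[of u] subcritical
      unfolding W\<^sub>0_def
      by (rule tendsto_lowerbound[OF _ eventually_mono])
        (auto intro!: less_imp_le stable_queue.idle_weight_pos stable_queue)
    have "1 = W\<^sub>0 [] * of_bool (?I [] = \<S>)" by (simp add: W\<^sub>0_def)
    also have "\<dots> \<le> V"
      unfolding V_def by (rule member_le_sum) (use pos finite_distinct in auto)
    finally show "0 < V" by simp
  qed
  moreover have "eventually (\<lambda>lam. G k lam / G (\<lambda>_. 0) lam =
      measure_pmf.expectation (\<pi> lam) (\<lambda>x. prod_list (map (tilt k lam) (fst x)))) \<F>"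
    using subcritical
  proof eventually_elim
    case (elim lam)
    show ?case
      unfolding G_def W_def rate_0
      by (rule stable_queue.cos_transform[OF stable_queue[OF elim] assms[OF elim] tilt_range[OF elim], symmetric])
  qed
  ultimately show ?thesis by (rule Lim_transform_eventually)
qed

section \<open>Weak convergence of the scaled queue vector\<close>

lemma orthant_prob_exp_times_vec: "orthant_prob (exp_times_vec \<S> p)"
  unfolding exp_times_vec_def
proof (rule orthant_prob_distr)
  show "prob_space (density lborel (\<lambda>t. ennreal (exponential_density 1 t)))"
    by (rule prob_space_exponential_density) simp
  show "AE t in density lborel (\<lambda>t. ennreal (exponential_density 1 t)). \<forall>j. 0 \<le> (t *\<^sub>R type_vec \<S> p) $ j"
    using p_pos
    by (subst AE_density)
      (auto simp: exponential_density_def type_vec_def less_imp_le not_less split: if_splits)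
qed measurable

lemma exp_times_vec_laplace:
  "(\<integral>x. exp (- (\<Sum>j\<in>UNIV. real (k j) * x $ j)) \<partial>exp_times_vec \<S> p) = 1 / (1 + dot k)"
proof -
  have "(\<Sum>j\<in>UNIV. real (k j) * (t *\<^sub>R type_vec \<S> p) $ j) = t * dot k" for t
    by (simp add: type_vec_def sum_distrib_left if_distrib sum.If_cases mult_ac cong: if_cong)
  then show ?thesis
    unfolding exp_times_vec_def
    by (subst integral_distr) (simp_all add: exponential_laplace[OF dot_nonneg])
qed

text \<open>The transform is known for the word \<open>waiting\<close>, while the law counts all
  jobs. The counts differ by at most N per type, so the transforms agree up to a factor between exp
  (- slack K) and 1, which tends to 1. For c.o.c. the word lists all jobs; for c.o.s. the excess is
  the jobs in service.\<close>

lemma weak_limit_scaled_queue: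
  fixes \<pi> :: "real \<Rightarrow> 's pmf" and jobs :: "'s \<Rightarrow> 'n set \<Rightarrow> nat" and waiting :: "'s \<Rightarrow> 'n set list"
  assumes supp: "\<And>lam x. lam \<in> {0<..<avg_speed \<mu>} \<Longrightarrow> x \<in> set_pmf (\<pi> lam) \<Longrightarrow> set (waiting x) \<subseteq> \<S>"
    and jobs: "\<And>x S. count_list (waiting x) S \<le> jobs x S \<and> jobs x S \<le> count_list (waiting x) S + CARD('n)"
    and lim: "\<And>k. ((\<lambda>lam. measure_pmf.expectation (\<pi> lam) (\<lambda>x. prod_list (map (tilt k lam) (waiting x)))) \<longlongrightarrow>
      1 / (1 + dot k)) \<F>"
  shows "weak_limit (\<lambda>lam. scaled_queue_law \<mu> \<S> lam jobs (\<pi> lam)) (exp_times_vec \<S> p) \<F>"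
proof (rule weak_limit_laplaceI)
  show "orthant_prob (exp_times_vec \<S> p)" by (rule orthant_prob_exp_times_vec)
  show "eventually (\<lambda>lam. orthant_prob (scaled_queue_law \<mu> \<S> lam jobs (\<pi> lam))) \<F>"
    using subcritical
  proof eventually_elim
    case (elim lam)
    then show ?case
      unfolding scaled_queue_law_def
      by (intro orthant_prob_distr measure_pmf.prob_space_axioms)
        (auto simp: type_vec_def dest!: slack_range simp: slack_def)
  qed
  fix k :: "'n set \<Rightarrow> nat"
  define f where "f lam x = exp (- slack lam * (\<Sum>S\<in>\<S>. real (k S) * real (jobs x S)))" for lam x
  define g where "g lam x = prod_list (map (tilt k lam) (waiting x))" for lam x
  \<comment> \<open>N extra jobs of each type, weighted by k: the largest contribution that jobs
    outside the word can make to the exponent before scaling.\<close>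
  define K where "K = real CARD('n) * (\<Sum>S\<in>\<S>. real (k S))"
  have law: "(\<integral>x. exp (- (\<Sum>j\<in>UNIV. real (k j) * x $ j)) \<partial>scaled_queue_law \<mu> \<S> lam jobs (\<pi> lam)) =
      measure_pmf.expectation (\<pi> lam) (f lam)" for lam
  proof -
    have "(\<Sum>j\<in>UNIV. real (k j) * (slack lam *\<^sub>R type_vec \<S> (\<lambda>S. real (jobs x S))) $ j) =
        slack lam * (\<Sum>S\<in>\<S>. real (k S) * real (jobs x S))" for x
      by (simp add: type_vec_def sum_distrib_left if_distrib sum.If_cases mult_ac cong: if_cong)
    then show ?thesis
      unfolding scaled_queue_law_def slack_def[symmetric] f_def by (subst integral_distr) simp_all
  qed
  have sandwich: "exp (- slack lam * K) * g lam x \<le> f lam x \<and> f lam x \<le> g lam x"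
    if lam: "lam \<in> {0<..<avg_speed \<mu>}" and x: "x \<in> set_pmf (\<pi> lam)" for lam x
  proof -
    let ?w = "\<Sum>S\<in>\<S>. real (k S) * real (count_list (waiting x) S)"
    have "(\<Sum>S\<in>UNIV. real (k S) * real (count_list (waiting x) S)) = ?w"
      using supp[OF lam x] by (intro sum.mono_neutral_right) (auto simp: count_list_0_iff)
    then have g: "g lam x = exp (- slack lam * ?w)"
      unfolding g_def tilt_def prod_list_exp_count by simp
    have le: "?w \<le> (\<Sum>S\<in>\<S>. real (k S) * real (jobs x S))"
      using jobs[of x] by (intro sum_mono mult_left_mono) auto
    have "(\<Sum>S\<in>\<S>. real (k S) * real (jobs x S)) \<le> (\<Sum>S\<in>\<S>. real (k S) * (real (count_list (waiting x) S) + real CARD('n)))"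
      using jobs[of x] by (intro sum_mono mult_left_mono) (auto simp flip: of_nat_add)
    also have "\<dots> = ?w + K"
      by (simp add: K_def distrib_left sum.distrib sum_distrib_left mult_ac)
    finally have ge: "(\<Sum>S\<in>\<S>. real (k S) * real (jobs x S)) \<le> ?w + K" .
    have s: "0 \<le> slack lam" using slack_range[OF lam] by simp
    have "slack lam * (\<Sum>S\<in>\<S>. real (k S) * real (jobs x S)) \<le> slack lam * K + slack lam * ?w"
      using mult_left_mono[OF ge s] by (simp add: distrib_left)
    then show ?thesis
      unfolding g f_def using mult_left_mono[OF le s] by (simp add: exp_add[symmetric])
  qed
  have bounds: "exp (- slack lam * K) * measure_pmf.expectation (\<pi> lam) (g lam) \<le>
      measure_pmf.expectation (\<pi> lam) (f lam) \<and>
      measure_pmf.expectation (\<pi> lam) (f lam) \<le> measure_pmf.expectation (\<pi> lam) (g lam)"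
    if lam: "lam \<in> {0<..<avg_speed \<mu>}" for lam
  proof -
    have s: "0 \<le> slack lam" using slack_range[OF lam] by simp
    have f: "integrable (measure_pmf (\<pi> lam)) (f lam)"
      using s by (intro measure_pmf.integrable_const_bound[where B=1])
        (auto simp: f_def intro!: AE_I2 mult_nonneg_nonneg sum_nonneg)
    have g: "integrable (measure_pmf (\<pi> lam)) (g lam)"
      unfolding g_def tilt_def prod_list_exp_count
      using s by (intro measure_pmf.integrable_const_bound[where B=1])
        (auto intro!: AE_I2 mult_nonneg_nonneg sum_nonneg)
    have "(\<integral>x. exp (- slack lam * K) * g lam x \<partial>\<pi> lam) \<le> (\<integral>x. f lam x \<partial>\<pi> lam)"
      using sandwich[OF lam] f g by (intro integral_mono_AE) (auto simp: AE_measure_pmf_iff)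
    moreover have "(\<integral>x. f lam x \<partial>\<pi> lam) \<le> (\<integral>x. g lam x \<partial>\<pi> lam)"
      using sandwich[OF lam] f g by (intro integral_mono_AE) (auto simp: AE_measure_pmf_iff)
    ultimately show ?thesis by simp
  qed
  have upper: "((\<lambda>lam. measure_pmf.expectation (\<pi> lam) (g lam)) \<longlongrightarrow> 1 / (1 + dot k)) \<F>"
    unfolding g_def by (rule lim)
  have "((\<lambda>lam. exp (- slack lam * K)) \<longlongrightarrow> exp (- 0 * K)) \<F>"
    by (intro tendsto_intros slack_tendsto)
  from tendsto_mult[OF this upper]
  have lower: "((\<lambda>lam. exp (- slack lam * K) * measure_pmf.expectation (\<pi> lam) (g lam)) \<longlongrightarrow> 1 / (1 + dot k)) \<F>"
    by simp
  show "((\<lambda>lam. \<integral>x. exp (- (\<Sum>j\<in>UNIV. real (k j) * x $ j)) \<partial>scaled_queue_law \<mu> \<S> lam jobs (\<pi> lam)) \<longlongrightarrow>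
      (\<integral>x. exp (- (\<Sum>j\<in>UNIV. real (k j) * x $ j)) \<partial>exp_times_vec \<S> p)) \<F>"
    unfolding law exp_times_vec_laplace
    by (rule tendsto_sandwich[OF _ _ lower upper])
      (use subcritical bounds in \<open>auto elim!: eventually_mono\<close>)
qed

lemma coc_weak_limit:
  assumes "\<And>lam. lam \<in> {0<..<avg_speed \<mu>} \<Longrightarrow> coc_stationary \<mu> \<S> p lam (\<pi> lam)"
  shows "weak_limit (\<lambda>lam. scaled_queue_law \<mu> \<S> lam coc_jobs (\<pi> lam)) (exp_times_vec \<S> p) \<F>"
proof (rule weak_limit_scaled_queue[where waiting="\<lambda>c. c"])
  show "set x \<subseteq> \<S>" if "lam \<in> {0<..<avg_speed \<mu>}" "x \<in> set_pmf (\<pi> lam)" for lam x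
    using assms[OF that(1)] that(2) by (auto simp: coc_stationary_def stationary_def coc_states_def)
  show "((\<lambda>lam. measure_pmf.expectation (\<pi> lam) (\<lambda>c. prod_list (map (tilt k lam) c))) \<longlongrightarrow>
      1 / (1 + dot k)) \<F>" for k
    using assms by (rule coc_transform_tendsto)
qed (simp add: coc_jobs_def)

lemma cos_weak_limit:
  assumes "\<And>lam. lam \<in> {0<..<avg_speed \<mu>} \<Longrightarrow> cos_stationary \<mu> \<S> p lam (\<pi> lam)"
  shows "weak_limit (\<lambda>lam. scaled_queue_law \<mu> \<S> lam cos_jobs (\<pi> lam)) (exp_times_vec \<S> p) \<F>"
proof (rule weak_limit_scaled_queue[where waiting=fst])
  show "set (fst x) \<subseteq> \<S>" if "lam \<in> {0<..<avg_speed \<mu>}" "x \<in> set_pmf (\<pi> lam)" for lam x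
  proof -
    have "x \<in> cos_states \<S>"
      using assms[OF that(1)] that(2) unfolding cos_stationary_def stationary_def by blast
    then show ?thesis by (cases x) (simp add: cos_states_def)
  qed
  show "count_list (fst x) S \<le> cos_jobs x S \<and> cos_jobs x S \<le> count_list (fst x) S + CARD('n)"
    for x :: "'n cos_state" and S
    by (cases x) (simp add: card_mono)
qed (rule cos_transform_tendsto[OF assms])

end

theorem theorem1:
  fixes \<mu> :: "'n::finite \<Rightarrow> real"
    and \<S> :: "'n set set"
    and p :: "'n set \<Rightarrow> real"
  assumes "\<And>n. 0 < \<mu> n"
    and "\<S> \<noteq> {}"
    and "{} \<notin> \<S>"
    and "\<Union>\<S> = UNIV"
    and "\<And>S. S \<in> \<S> \<Longrightarrow> 0 < p S"
    and "(\<Sum>S\<in>\<S>. p S) = 1"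
  shows "(local_stability \<mu> \<S> p \<longleftrightarrow> local_stability_servers \<mu> \<S> p) \<and>
    (local_stability \<mu> \<S> p \<longrightarrow>
      (\<forall>\<pi> :: real \<Rightarrow> 'n coc_state pmf.
         (\<forall>lam\<in>{0<..<avg_speed \<mu>}. coc_stationary \<mu> \<S> p lam (\<pi> lam)) \<longrightarrow>
         weak_limit (\<lambda>lam. scaled_queue_law \<mu> \<S> lam coc_jobs (\<pi> lam)) (exp_times_vec \<S> p)
           (at_left (avg_speed \<mu>))) \<and>
      (\<forall>\<pi> :: real \<Rightarrow> 'n cos_state pmf.
         (\<forall>lam\<in>{0<..<avg_speed \<mu>}. cos_stationary \<mu> \<S> p lam (\<pi> lam)) \<longrightarrow>
         weak_limit (\<lambda>lam. scaled_queue_law \<mu> \<S> lam cos_jobs (\<pi> lam)) (exp_times_vec \<S> p)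
           (at_left (avg_speed \<mu>))))"
proof -
  interpret replication_system \<mu> \<S> p
    using assms by unfold_locales
  have heavy: "heavy_traffic \<mu> \<S> p" if "local_stability \<mu> \<S> p"
    using that by unfold_locales
  show ?thesis
    using local_stability_iff heavy_traffic.coc_weak_limit[OF heavy] heavy_traffic.cos_weak_limit[OF heavy]
    by blast
qed

end
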